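(* For $n\ge1$ let $\mathbf{a}^{(n)}=(a_{n,1},\dots,a_{n,n})$ with $a_{n,k}=\frac{1}{n!}\binom{n}{k}(H_n-H_{n-k})$, $H_m=\sum_{i=1}^m 1/i$, be the coefficient sequence of $A_n(x)=\sum_{k=1}^n a_{n,k}x^{k-1}$. Then for every $1\le n\le 300$, the sequence $\mathbf{a}^{(n)}$ is infinite logconcave.
   Context: For a finite sequence $\mathbf{a}=(a_j)$ indexed by $j$ in a finite interval of integers, define $\mathfrak{L}(\mathbf{a})$ as the sequence on the same index set with entries $a_j^2-a_{j-1}a_{j+1}$, where $a_j=0$ for indices outside the index set. A sequence is $r$-logconcave if $\mathfrak{L}^{(s)}(\mathbf{a})$ has all entries positive for $0\le s\le r$, and infinite logconcave if it is $r$-logconcave for every $r\in\mathbb{N}$. *)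

theory Defs
  imports "HOL-Analysis.Harmonic_Numbers"
begin

text \<open>
  A finite real sequence indexed by the integer interval \<open>{l..u}\<close> is represented by a function
  on all integers together with the bounds \<open>l\<close>, \<open>u\<close>; values outside \<open>{l..u}\<close> carry no meaning
  and are read as \<open>0\<close> through \<open>zero_ext\<close>.
\<close>

definition zero_ext :: "int \<Rightarrow> int \<Rightarrow> (int \<Rightarrow> real) \<Rightarrow> int \<Rightarrow> real" where
  "zero_ext l u a j = (if j \<in> {l..u} then a j else 0)"

definition L_op :: "int \<Rightarrow> int \<Rightarrow> (int \<Rightarrow> real) \<Rightarrow> int \<Rightarrow> real" where
  "L_op l u a j = (zero_ext l u a j)\<^sup>2 - zero_ext l u a (j - 1) * zero_ext l u a (j + 1)"

definition logconcave_order :: "int \<Rightarrow> int \<Rightarrow> nat \<Rightarrow> (int \<Rightarrow> real) \<Rightarrow> bool" where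
  "logconcave_order l u r a \<longleftrightarrow> (\<forall>s\<le>r. \<forall>j\<in>{l..u}. (L_op l u ^^ s) a j > 0)"

definition infinite_logconcave :: "int \<Rightarrow> int \<Rightarrow> (int \<Rightarrow> real) \<Rightarrow> bool" where
  "infinite_logconcave l u a \<longleftrightarrow> (\<forall>r. logconcave_order l u r a)"

definition A_coeff :: "nat \<Rightarrow> nat \<Rightarrow> real" where
  "A_coeff n k = 1 / fact n * real (n choose k) * (harm n - harm (n - k))"

text \<open>
  The coefficients of \<open>A\<^sub>n(x)\<close>, the coefficient of \<open>x\<^sup>k\<^sup>-\<^sup>1\<close> being placed at index \<open>k\<close>;
  meaningful on \<open>{1..n}\<close>.
\<close>

definition A_seq :: "nat \<Rightarrow> int \<Rightarrow> real" where
  "A_seq n j = A_coeff n (nat j)"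

end

theory Submission
  imports Defs
begin

text \<open>
  Up to positive factors, the sequence consists of the entries
  \<open>\<alpha> n k = (n choose k) * (harm n - harm (n - k))\<close> of a triangle obeying Pascal's rule
  \<open>\<alpha> (n + 1) k = \<alpha> n k + \<alpha> n (k - 1)\<close>, where \<open>1 / (n + 1)\<close> is added at \<open>k = n + 1\<close>.
  By McNamara and Sagan, a sequence is infinite logconcave as soon as
  \<open>\<phi>\<^sup>2 * x (k - 1) * x (k + 1) \<le> (x k)\<^sup>2\<close> for all \<open>k\<close>, with the golden ratio \<open>\<phi>\<close>. Here this
  holds after at most seven applications of the operator, because the ratio
  \<open>(x k)\<^sup>2 / ((x k)\<^sup>2 - x (k - 1) * x (k + 1))\<close>, whose maximum starts at about \<open>n / 4\<close>, is roughly
  halved by each of them. The same ratio controls the loss of precision, so the iterates can be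
  computed in floating point arithmetic with at most 16 octal digits and rigorous error bounds.
  All computations are carried out by rewriting with proved equations.
\<close>

section \<open>Octal arithmetic\<close>

text \<open>Why the ratio halves: with
  \<open>\<rho> k = x (k - 1) * x (k + 1) / (x k)\<^sup>2\<close> one has
  \<open>L_nat x k = (x k)\<^sup>2 * (1 - \<rho> k)\<close>. Where \<open>\<rho>\<close> varies
  slowly with \<open>k\<close>, the new quotient is close to \<open>(\<rho> k)\<^sup>2\<close>, and
  \<open>1 - \<rho>\<^sup>2 = (1 + \<rho>) * (1 - \<rho>)\<close> is nearly twice as large as
  \<open>1 - \<rho>\<close>. For the binomial factor alone,
  \<open>1 / (1 - \<rho> k) = (k + 1) * (n - k + 1) / (n + 1)\<close>, which explains the initial
  maximum near \<open>n / 4\<close>. This only guides the choice of parameters; the bound on the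
  cancellation is checked at every entry. Exact iterates double their length in every step. Rounding
  keeps the mantissas short, but exponents would still double; therefore only their second
  differences along the row are stored, and these stay small. Base 8 suits the rewriting: a binary
  numeral splits into digits three bits at a time, and a multiplication table with summand and carry
  needs just \<open>8 ^ 4\<close> rules.\<close>

fun oval :: "nat list \<Rightarrow> nat" where
  "oval [] = 0"
| "oval (x # xs) = x + 8 * oval xs"

definition octal :: "nat list \<Rightarrow> bool" where
  "octal xs \<longleftrightarrow> (\<forall>x\<in>set xs. x < 8)"

lemma octal_simps [simp]:
  "octal []" "octal (x # xs) \<longleftrightarrow> x < 8 \<and> octal xs" "octal (xs @ ys) \<longleftrightarrow> octal xs \<and> octal ys"
  "octal (rev xs) \<longleftrightarrow> octal xs"
  by (auto simp: octal_def)

lemma octal_drop: "octal xs \<Longrightarrow> octal (drop r xs)"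
  by (meson in_set_dropD octal_def)

lemma oval_append: "oval (xs @ ys) = oval xs + 8 ^ length xs * oval ys"
  by (induction xs) (auto simp: algebra_simps)

lemma oval_less: "octal xs \<Longrightarrow> oval xs < 8 ^ length xs"
proof (induction xs)
  case (Cons x xs)
  then have "oval xs + 1 \<le> 8 ^ length xs" "x < 8" by simp_all
  then show ?case by simp
qed simp

text \<open>Used in contrapositive form: a mantissa of \<open>p\<close> digits with
  \<open>8 ^ p \<le> 8 * oval m\<close> has a nonzero top digit, so its square is delivered with
  exactly \<open>2 * p\<close> digits.\<close>

lemma oval_less_last: "octal xs \<Longrightarrow> xs \<noteq> [] \<Longrightarrow> last xs = 0 \<Longrightarrow> 8 * oval xs < 8 ^ length xs"
proof (induction xs)
  case (Cons x xs)
  show ?case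
  proof (cases "xs = []")
    case False
    with Cons have "8 * oval xs + 8 \<le> 8 ^ length xs"
      by (cases "length xs") auto
    then show ?thesis using Cons.prems by simp
  qed (use Cons in simp)
qed simp

lemma oval_drop: "octal xs \<Longrightarrow> oval (drop r xs) = oval xs div 8 ^ r"
proof (induction xs arbitrary: r)
  case (Cons x xs)
  then show ?case by (cases r) (auto simp: div_mult2_eq)
qed simp

section \<open>Multiplication, addition, subtraction and comparison of digit lists\<close>

fun muladd_digit :: "nat \<Rightarrow> nat \<Rightarrow> nat list \<Rightarrow> nat list \<Rightarrow> nat list" where
  "muladd_digit d c [] ys = [c]"
| "muladd_digit d c (x # xs) [] =
    ((d * x + c) mod 8) # muladd_digit d ((d * x + c) div 8) xs []"
| "muladd_digit d c (x # xs) (y # ys) =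
    ((d * x + y + c) mod 8) # muladd_digit d ((d * x + y + c) div 8) xs ys"

text \<open>Since \<open>7 * 7 + 7 + 7 = 63\<close>, the outgoing carry is again below 8. It is a
  single digit, so that multiplier and carry together can select one of 64 functions.\<close>

lemma muladd_digit:
  assumes "length ys \<le> length xs" "d < 8" "c < 8" "octal xs" "octal ys"
  shows "oval (muladd_digit d c xs ys) = d * oval xs + oval ys + c"
    and "octal (muladd_digit d c xs ys)"
    and "length (muladd_digit d c xs ys) = Suc (length xs)"
proof -
  have carry: "(d * x + y + c) div 8 < 8" if "d < 8" "x < 8" "y < 8" "c < 8" for d x y c :: nat
  proof -
    have "d * x \<le> 7 * 7" using that by (intro mult_le_mono) auto
    then show ?thesis using that by linarith
  qed
  have "oval (muladd_digit d c xs ys) = d * oval xs + oval ys + c \<and> octal (muladd_digit d c xs ys)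
      \<and> length (muladd_digit d c xs ys) = Suc (length xs)"
    using assms
  proof (induction d c xs ys rule: muladd_digit.induct)
    case (1 d c ys)
    then show ?case by simp
  next
    case (2 d c x xs)
    from 2 carry[of d x 0 c] show ?case by (auto simp: algebra_simps)
  next
    case (3 d c x xs y ys)
    from 3 carry[of d x y c] show ?case by (auto simp: algebra_simps)
  qed
  then show "oval (muladd_digit d c xs ys) = d * oval xs + oval ys + c"
    and "octal (muladd_digit d c xs ys)"
    and "length (muladd_digit d c xs ys) = Suc (length xs)" by auto
qed

fun muladd :: "nat list \<Rightarrow> nat list \<Rightarrow> nat list \<Rightarrow> nat list" where
  "muladd [] ys acc = acc"
| "muladd (d # ds) ys acc =
    (if d = 0 then if acc = [] then 0 # muladd ds ys [] else hd acc # muladd ds ys (tl acc)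
     else hd (muladd_digit d 0 ys acc) # muladd ds ys (tl (muladd_digit d 0 ys acc)))"

text \<open>The accumulator never outgrows \<open>ys\<close>: a nonzero digit yields
  \<open>Suc (length ys)\<close> digits, the lowest of which is output at once. If the top digit of
  \<open>ds\<close> is nonzero, the last accumulator has full length, leading zeros included;
  positions in a product are then known without counting.\<close>

lemma muladd:
  assumes "length acc \<le> length ys" "octal ds" "octal ys" "octal acc"
  shows "oval (muladd ds ys acc) = oval ds * oval ys + oval acc \<and> octal (muladd ds ys acc)
    \<and> (ds \<noteq> [] \<and> last ds \<noteq> 0 \<longrightarrow> length (muladd ds ys acc) = length ds + length ys)"
  using assms
proof (induction ds arbitrary: acc)
  case (Cons d ds)
  show ?case
  proof (cases "d = 0")
    case True
    then show ?thesis using Cons.IH[of "tl acc"] Cons.prems by (cases acc) (auto simp: algebra_simps)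
  next
    case False
    let ?v = "muladd_digit d 0 ys acc"
    have v: "oval ?v = d * oval ys + oval acc" "octal ?v" "length ?v = Suc (length ys)"
      using muladd_digit[of acc ys d 0] Cons.prems by simp_all
    then obtain z zs where zs: "?v = z # zs" by (cases ?v) auto
    have "oval (muladd ds ys zs) = oval ds * oval ys + oval zs \<and> octal (muladd ds ys zs)
      \<and> (ds \<noteq> [] \<and> last ds \<noteq> 0 \<longrightarrow> length (muladd ds ys zs) = length ds + length ys)"
      using Cons.IH[of zs] Cons.prems v zs by simp
    then show ?thesis using False v zs by (cases "ds = []") (auto simp: algebra_simps)
  qed
qed simp

fun add_carry :: "nat list \<Rightarrow> nat list \<Rightarrow> bool \<Rightarrow> nat list" where
  "add_carry [] [] b = (if b then [1] else [])"
| "add_carry (x # xs) [] b = (if b then ((x + 1) mod 8) # add_carry xs [] (8 \<le> x + 1) else x # xs)"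
| "add_carry [] (y # ys) b = (if b then ((y + 1) mod 8) # add_carry [] ys (8 \<le> y + 1) else y # ys)"
| "add_carry (x # xs) (y # ys) b =
    ((x + y + of_bool b) mod 8) # add_carry xs ys (8 \<le> x + y + of_bool b)"

lemma add_carry:
  assumes "octal xs" "octal ys"
  shows "oval (add_carry xs ys b) = oval xs + oval ys + of_bool b \<and> octal (add_carry xs ys b)"
proof -
  have carry: "v mod 8 + 8 * of_bool (8 \<le> v) = v" if "v < 16" for v :: nat
    using that by (cases "8 \<le> v") (auto simp: mod_if)
  show ?thesis using assms
  proof (induction xs ys b rule: add_carry.induct)
    case (2 x xs b)
    from 2 carry[of "x + 1"] show ?case by (auto simp: algebra_simps)
  next
    case (3 y ys b)
    from 3 carry[of "y + 1"] show ?case by (auto simp: algebra_simps)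
  next
    case (4 x xs y ys b)
    have "x + y + of_bool b < 16" using 4 by (cases b) auto
    from 4 carry[OF this] show ?case by (auto simp: algebra_simps)
  qed simp
qed

text \<open>The difference comes out most significant digit first, because its leading zeros are
  stripped next. It keeps the length of the minuend; a negative difference gives
  \<open>[]\<close>.\<close>

fun subtract_rev :: "nat list \<Rightarrow> nat list \<Rightarrow> bool \<Rightarrow> nat list \<Rightarrow> nat list" where
  "subtract_rev [] [] b acc = (if b then [] else acc)"
| "subtract_rev [] (y # ys) b acc = (if y = 0 then subtract_rev [] ys b acc else [])"
| "subtract_rev (x # xs) [] b acc =
    subtract_rev xs [] (x < of_bool b) ((8 + x - of_bool b) mod 8 # acc)"
| "subtract_rev (x # xs) (y # ys) b acc =
    subtract_rev xs ys (x < y + of_bool b) ((8 + x - (y + of_bool b)) mod 8 # acc)"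

lemma subtract_rev:
  assumes "octal xs" "octal ys" "subtract_rev xs ys b acc \<noteq> []"
  shows "\<exists>zs. subtract_rev xs ys b acc = rev zs @ acc \<and> length zs = length xs \<and> octal zs
    \<and> oval zs + oval ys + of_bool b = oval xs"
proof -
  \<comment> \<open>The value \<open>v = 8\<close> occurs when the digit 7 meets a borrow.\<close>
  have borrow: "(8 + x - v) mod 8 + v = x + 8 * of_bool (x < v)" if "x < 8" "v \<le> 8" for x v :: nat
    using that by (cases "x < v") (auto simp: mod_if)
  show ?thesis using assms
  proof (induction xs ys b acc rule: subtract_rev.induct)
    case (1 b acc)
    then show ?case by (auto split: if_splits)
  next
    case (2 y ys b acc)
    then show ?case by (auto split: if_splits)
  next
    case (3 x xs b acc)
    let ?z = "(8 + x - of_bool b) mod 8"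
    from 3 obtain zs where zs: "subtract_rev xs [] (x < of_bool b) (?z # acc) = rev zs @ ?z # acc"
      "length zs = length xs" "octal zs" "oval zs + of_bool (x < of_bool b) = oval xs" by auto
    have "?z + of_bool b = x + 8 * of_bool (x < of_bool b)"
      using 3 by (intro borrow) auto
    then show ?case using zs 3 by (intro exI[of _ "?z # zs"]) auto
  next
    case (4 x xs y ys b acc)
    let ?v = "y + of_bool b" let ?z = "(8 + x - ?v) mod 8"
    from 4 obtain zs where zs: "subtract_rev xs ys (x < ?v) (?z # acc) = rev zs @ ?z # acc"
      "length zs = length xs" "octal zs" "oval zs + oval ys + of_bool (x < ?v) = oval xs" by auto
    have "?z + ?v = x + 8 * of_bool (x < ?v)"
      using 4 by (intro borrow) auto
    then show ?case using zs 4 by (intro exI[of _ "?z # zs"]) auto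
  qed
qed

text \<open>Digits are read from the least significant end; \<open>b\<close> is the verdict on those
  already read, and a later digit overrides it unless the two digits agree.\<close>

fun below :: "nat list \<Rightarrow> nat list \<Rightarrow> bool \<Rightarrow> bool" where
  "below [] [] b \<longleftrightarrow> b"
| "below [] (y # ys) b \<longleftrightarrow> below [] ys (0 < y \<or> b)"
| "below (x # xs) [] b \<longleftrightarrow> below xs [] (x = 0 \<and> b)"
| "below (x # xs) (y # ys) b \<longleftrightarrow> below xs ys (x < y \<or> x = y \<and> b)"

lemma below:
  assumes "octal xs" "octal ys"
  shows "below xs ys b \<longleftrightarrow> oval xs < oval ys \<or> oval xs = oval ys \<and> b"
  using assms by (induction xs ys b rule: below.induct) (simp, (auto; presburger)+)

fun take_rev :: "nat \<Rightarrow> nat list \<Rightarrow> nat list \<Rightarrow> nat list" where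
  "take_rev 0 xs acc = acc"
| "take_rev (Suc p) [] acc = []"
| "take_rev (Suc p) (x # xs) acc = take_rev p xs (x # acc)"

lemma take_rev: "take_rev p xs acc = (if p \<le> length xs then rev (take p xs) @ acc else [])"
  by (induction p xs acc rule: take_rev.induct) auto

section \<open>One entry of the operator in rounded arithmetic\<close>

text \<open>In all functions below an empty list signals failure, and every failure propagates to the
  final test.\<close>

definition entry :: "nat \<Rightarrow> nat \<Rightarrow> nat list \<Rightarrow> bool \<Rightarrow> nat list" where
  "entry r j m b = (if b then j # r # m else [])"

text \<open>The amplification of errors is certified here, entry by entry: success means
  \<open>oval S < oval G * oval m * 8 ^ j\<close>, so the square is less than \<open>oval G\<close>
  times the truncated difference.\<close>

definition guard :: "nat list \<Rightarrow> nat \<Rightarrow> nat list \<Rightarrow> nat \<Rightarrow> nat list \<Rightarrow> nat list" where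
  "guard G r S j m = entry r j m (below (drop j S) (muladd G m []) False)"

text \<open>\<open>j\<close> is the number of digits to be cut off below the \<open>q\<close> digits
  kept. Each leading zero lost by cancellation uses up one of them; if none is left, fewer than
  \<open>q\<close> significant digits would remain.\<close>

fun strip :: "nat list \<Rightarrow> nat \<Rightarrow> nat \<Rightarrow> nat list \<Rightarrow> nat \<Rightarrow> nat list \<Rightarrow> nat list" where
  "strip G q r S j [] = []"
| "strip G q r S j (x # xs) =
    (if x = 0 then (case j of 0 \<Rightarrow> [] | Suc i \<Rightarrow> strip G q r S i xs)
     else guard G r S j (take_rev q (x # xs) []))"

text \<open>A stored exponent \<open>r\<close> stands for the factor \<open>8 / 8 ^ r\<close>; the
  digit 0 put in front of \<open>T\<close> supplies the 8. Normalised mantissas of equal length have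
  \<open>l * u > m\<^sup>2 / 64\<close>, so in a logconcave row the factor is below 64, hence at
  most 8, and this bias makes \<open>r\<close> a natural number.\<close>

definition entry_of :: "nat list \<Rightarrow> nat \<Rightarrow> nat \<Rightarrow> nat \<Rightarrow> nat list \<Rightarrow> nat list \<Rightarrow> nat list" where
  "entry_of G q J r S T = strip G q r S J (subtract_rev S (drop r (0 # T)) False [])"

definition L_entry ::
    "nat list \<Rightarrow> nat \<Rightarrow> nat \<Rightarrow> nat \<Rightarrow> nat list \<Rightarrow> nat list \<Rightarrow> nat list \<Rightarrow> nat list" where
  "L_entry G q J r l m u = entry_of G q J r (muladd m m []) (muladd l u [])"

lemma strip_nonempty:
  assumes "strip G q r S J ds \<noteq> []"
  shows "\<exists>z x xs. ds = replicate z 0 @ x # xs \<and> x \<noteq> 0 \<and> z \<le> J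
    \<and> strip G q r S J ds = guard G r S (J - z) (take_rev q (x # xs) [])"
  using assms
proof (induction G q r S J ds rule: strip.induct)
  case (2 G q r S j x xs)
  show ?case
  proof (cases "x = 0")
    case True
    with 2 obtain i where i: "j = Suc i" "strip G q r S i xs \<noteq> []" by (auto split: nat.splits)
    with 2 True obtain z y ys where "xs = replicate z 0 @ y # ys" "y \<noteq> 0" "z \<le> i"
      "strip G q r S i xs = guard G r S (i - z) (take_rev q (y # ys) [])" by fastforce
    then show ?thesis using True i by (intro exI[of _ "Suc z"] exI[of _ y] exI[of _ ys]) simp
  next
    case False
    then show ?thesis by (intro exI[of _ 0] exI[of _ x] exI[of _ xs]) simp
  qed
qed simp

text \<open>The square has \<open>2 * p\<close> digits and so has the difference. After
  \<open>z\<close> leading zeros the top \<open>q\<close> digits form \<open>m'\<close>, with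
  \<open>j = 2 * p - q - z\<close> digits below them; dropping those loses less than
  \<open>8 ^ j\<close>.\<close>

lemma L_entry:
  assumes "octal G" "octal l" "octal m" "octal u" "length m = p" "0 < q" "q \<le> 2 * p"
    and big_m: "8 ^ p \<le> 8 * oval m"
  assumes "L_entry G q (2 * p - q) r l m u \<noteq> []"
  shows "\<exists>j m'. L_entry G q (2 * p - q) r l m u = j # r # m' \<and> octal m' \<and> length m' = q
    \<and> 8 ^ q \<le> 8 * oval m' \<and> (oval m)\<^sup>2 < oval G * oval m' * 8 ^ j
    \<and> oval m' * 8 ^ j + 8 * (oval l * oval u) div 8 ^ r \<le> (oval m)\<^sup>2
    \<and> (oval m)\<^sup>2 < (oval m' + 1) * 8 ^ j + 8 * (oval l * oval u) div 8 ^ r"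
proof -
  define S T where "S = muladd m m []" and "T = drop r (0 # muladd l u [])"
  have "m \<noteq> []" using assms by auto
  then have "last m \<noteq> 0" using oval_less_last[of m] assms by auto
  then have S: "oval S = (oval m)\<^sup>2" "octal S" "length S = 2 * p"
    using muladd[of "[]" m m] assms \<open>m \<noteq> []\<close> by (auto simp: S_def power2_eq_square)
  have T: "oval T = 8 * (oval l * oval u) div 8 ^ r" "octal T"
    using muladd[of "[]" u l] oval_drop[of "0 # muladd l u []" r] octal_drop[of "0 # muladd l u []" r] assms
    by (auto simp: T_def)
  define ds where "ds = subtract_rev S T False []"
  have E: "L_entry G q (2 * p - q) r l m u = strip G q r S (2 * p - q) ds"
    by (simp add: L_entry_def entry_of_def S_def T_def ds_def)
  with assms obtain z x xs where z: "ds = replicate z 0 @ x # xs" "x \<noteq> 0" "z \<le> 2 * p - q"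
    "strip G q r S (2 * p - q) ds = guard G r S (2 * p - q - z) (take_rev q (x # xs) [])"
    using strip_nonempty[of G q r S "2 * p - q" ds] by auto
  have "ds \<noteq> []" using z by auto
  then obtain D where D: "ds = rev D" "length D = 2 * p" "octal D" "oval D + oval T = oval S"
    using subtract_rev[of S T False "[]"] S T by (auto simp: ds_def)
  define j m' where "j = 2 * p - q - z" and "m' = take_rev q (x # xs) []"
  have len: "Suc (length xs) + z = 2 * p"
    using arg_cong[OF z(1), of length] D by simp
  then have q: "q \<le> length (x # xs)" using z(3) assms by simp
  \<comment> \<open>Read from the least significant end, the difference is
    \<open>low @ m' @ replicate z 0\<close>.\<close>
  define low where "low = rev (drop q (x # xs))"
  have m': "m' = rev (take q (x # xs))" using q by (simp add: m'_def take_rev)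
  have "D = rev ds" using D by simp
  also have "\<dots> = rev (x # xs) @ replicate z 0" using z by simp
  also have "rev (x # xs) = low @ m'"
    unfolding m' low_def by (metis append_take_drop_id rev_append)
  finally have D_eq: "D = low @ m' @ replicate z 0" by simp
  have rep: "oval (replicate z 0) = 0" by (induction z) auto
  have len_low: "length low = j" using len q by (simp add: low_def j_def)
  have low: "length low = j" "oval low < 8 ^ j"
    using len_low oval_less[of low] D(3) by (auto simp: D_eq)
  have D_val: "oval D = oval low + 8 ^ j * oval m'"
    using low by (simp add: D_eq oval_append rep)
  obtain q' where q': "q = Suc q'" using assms by (cases q) auto
  have "m' = rev (take q' xs) @ [x]" by (simp add: m' q')
  moreover have "length (rev (take q' xs)) = q'" using q q' by simp
  ultimately have "8 ^ q' * x \<le> oval m'" by (simp add: oval_append)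
  moreover have "8 ^ q' \<le> 8 ^ q' * x" using z by simp
  ultimately have "8 ^ q' \<le> oval m'" by (rule order.trans[rotated])
  then have big: "8 ^ q \<le> 8 * oval m'" by (simp add: q')
  have len': "length m' = q" using q by (simp add: m')
  have oct': "octal m'" using D(3) by (simp add: D_eq)
  have ne: "guard G r S j m' \<noteq> []" using assms E z by (simp add: j_def m'_def)
  have "m' \<noteq> []" using len' assms by auto
  then have "oval (muladd G m' []) = oval G * oval m'" "octal (muladd G m' [])"
    using muladd[of "[]" m' G] oct' assms by auto
  moreover from ne have "below (drop j S) (muladd G m' []) False"
    by (auto simp: guard_def entry_def split: if_splits)
  ultimately have "oval S div 8 ^ j < oval G * oval m'"
    using below[of "drop j S" "muladd G m' []" False] octal_drop[of S j] S oval_drop[of S j] by simp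
  then have small: "oval S < oval G * oval m' * 8 ^ j"
    by (simp add: div_less_iff_less_mult)
  have "L_entry G q (2 * p - q) r l m u = j # r # m'"
    using E z ne by (auto simp: j_def m'_def guard_def entry_def split: if_splits)
  then show ?thesis
    using oct' len' big small S T D D_val low
    by (intro exI[of _ j] exI[of _ m']) (auto simp: algebra_simps)
qed

section \<open>The rounded iteration\<close>

fun L_entries :: "nat list \<Rightarrow> nat \<Rightarrow> nat \<Rightarrow> nat list \<Rightarrow> nat list list \<Rightarrow> nat list list" where
  "L_entries G q J l ((r # m) # (r' # m') # st) =
    L_entry G q J r l m m' # L_entries G q J m ((r' # m') # st)"
| "L_entries G q J l [r # m] = [L_entry G q J r l m []]"
| "L_entries G q J l _ = [[]]"

fun with_difference :: "nat \<Rightarrow> nat \<Rightarrow> nat list \<Rightarrow> nat list" where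
  "with_difference a 0 m = a # m"
| "with_difference 0 (Suc b) m = []"
| "with_difference (Suc a) (Suc b) m = with_difference a b m"

text \<open>The new exponent is \<open>2 * r + 2 * j - i - i' - 1\<close>, where \<open>i\<close>
  and \<open>i'\<close> are the neighbouring shifts. Lowering \<open>j\<close>, \<open>i\<close> and
  \<open>i'\<close> together does not change it, and doing this early keeps the unary numbers
  small.\<close>

fun with_shift :: "nat \<Rightarrow> nat \<Rightarrow> nat \<Rightarrow> nat \<Rightarrow> nat list \<Rightarrow> nat list" where
  "with_shift r (Suc j) (Suc i) (Suc i') m = with_shift r j i i' m"
| "with_shift r j i i' m = with_difference (r + (r + (j + j))) (Suc (i + i')) m"

text \<open>\<open>i\<close> is the shift of the left neighbour. At both ends of a row the exponent
  is a dummy 0: a neighbour is missing there, so the product that it would scale vanishes.\<close>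

fun update_tail :: "nat \<Rightarrow> nat list list \<Rightarrow> nat list list" where
  "update_tail i [] = []"
| "update_tail i [j # r # m] = [0 # m]"
| "update_tail i ((j # r # m) # (j' # r' # m') # es) =
    with_shift r j i j' m # update_tail j ((j' # r' # m') # es)"
| "update_tail i _ = [[]]"

fun update :: "nat list list \<Rightarrow> nat list list" where
  "update ((j # r # m) # es) = (0 # m) # update_tail j es"
| "update _ = [[]]"

text \<open>The three zeros multiply by \<open>8 * 64\<close>: one factor 8 is the bias of the
  exponent, 64 is the denominator of the threshold \<open>t / 64\<close>.\<close>

definition final_test :: "nat list \<Rightarrow> nat \<Rightarrow> nat list \<Rightarrow> nat list \<Rightarrow> bool" where
  "final_test t r S T \<longleftrightarrow> below (drop r (0 # 0 # 0 # T)) (muladd t S []) False"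

fun final :: "nat list \<Rightarrow> nat list \<Rightarrow> nat list list \<Rightarrow> bool" where
  "final t l ((r # m) # (r' # m') # st) \<longleftrightarrow>
    final_test t r (muladd m m []) (muladd l m' []) \<and> final t m ((r' # m') # st)"
| "final t l [r # m] \<longleftrightarrow> True"
| "final t l _ \<longleftrightarrow> False"

text \<open>A schedule lists for every step the precision \<open>q\<close> of the result and the digits of a bound \<open>G\<close>
  on the cancellation \<open>(x k)\<^sup>2 / L_nat x k\<close>, by which relative errors are amplified. After the last
  step, \<open>x (k - 1) * x (k + 1) / (x k)\<^sup>2\<close> must not exceed \<open>t / 64\<close>.\<close>

fun run :: "nat list \<Rightarrow> nat \<Rightarrow> (nat \<times> nat list) list \<Rightarrow> nat list list \<Rightarrow> bool" where
  "run t p [] st \<longleftrightarrow> final t [] st"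
| "run t p ((q, G) # sched) st \<longleftrightarrow> run t q sched (update (L_entries G q (p + p - q) [] st))"

text \<open>\<open>e\<close> bounds the relative error. For \<open>e \<le> 1 / 50\<close> the error
  \<open>2 * e + e\<^sup>2\<close> of a product is at most \<open>202 / 100 * e\<close>; two
  products enter a difference, \<open>G\<close> makes their errors relative to that difference, and
  \<open>8 / 8 ^ q\<close> bounds one unit in the last place. At the end,
  \<open>26181 / 10000\<close> is slightly above the square of the golden ratio.\<close>

fun error_ok :: "nat list \<Rightarrow> real \<Rightarrow> nat \<Rightarrow> (nat \<times> nat list) list \<Rightarrow> bool" where
  "error_ok t e p [] \<longleftrightarrow> octal t \<and> e < 1 \<and>
    26181 / 10000 * (real (oval t) / 64) * (1 + e)\<^sup>2 \<le> (1 - e)\<^sup>2"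
| "error_ok t e p ((q, G) # sched) \<longleftrightarrow> e \<le> 1 / 50 \<and> 0 < q \<and> q \<le> 2 * p \<and> octal G \<and>
    error_ok t (2 * real (oval G) * (202 / 100 * e) + 8 / 8 ^ q) q sched"

section \<open>Entrywise description of a step and propagation of failure\<close>

lemma L_entries_nth:
  assumes "[] \<notin> set st" "st \<noteq> []"
  shows "length (L_entries G q J l st) = length st \<and> (\<forall>i<length st. L_entries G q J l st ! i =
    L_entry G q J (hd (st ! i)) (if i = 0 then l else tl (st ! (i - 1))) (tl (st ! i))
      (if Suc i < length st then tl (st ! Suc i) else []))"
  using assms
proof (induction G q J l st rule: L_entries.induct)
  case (1 G q J l r m r' m' st)
  then show ?case by (auto simp: nth_Cons split: nat.splits)
qed auto

lemma L_entries_failure: "[] \<in> set st \<or> st = [] \<Longrightarrow> [] \<in> set (L_entries G q J l st)"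
  by (induction G q J l st rule: L_entries.induct) auto

lemma final_failure: "[] \<in> set st \<or> st = [] \<Longrightarrow> \<not> final t l st"
  by (induction t l st rule: final.induct) auto

lemma with_difference: "with_difference a b m \<noteq> [] \<Longrightarrow> \<exists>c. with_difference a b m = c # m \<and> c + b = a"
  by (induction a b m rule: with_difference.induct) auto

lemma with_shift:
  "with_shift r j i i' m \<noteq> [] \<Longrightarrow>
    \<exists>c. with_shift r j i i' m = c # m \<and> c + Suc (i + i') = r + (r + (j + j))"
proof (induction r j i i' m rule: with_shift.induct)
  case (1 r j i i' m)
  then show ?case by fastforce
qed (auto dest: with_difference)

lemma update_tail:
  "[] \<notin> set (update_tail i es) \<Longrightarrow> length (update_tail i es) = length es \<and>
    (\<forall>k<length es. \<exists>j r m r'. es ! k = j # r # m \<and> update_tail i es ! k = r' # m \<and>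
      (Suc k < length es \<longrightarrow>
        r' + Suc ((if k = 0 then i else hd (es ! (k - 1))) + hd (es ! Suc k)) = r + (r + (j + j))))"
proof (induction i es rule: update_tail.induct)
  case (3 i j r m j' r' m' es)
  let ?es = "(j' # r' # m') # es"
  have IH: "length (update_tail j ?es) = length ?es"
    "\<And>k. k < length ?es \<Longrightarrow> \<exists>j'' r m r'. ?es ! k = j'' # r # m \<and> update_tail j ?es ! k = r' # m \<and>
      (Suc k < length ?es \<longrightarrow>
        r' + Suc ((if k = 0 then j else hd (?es ! (k - 1))) + hd (?es ! Suc k)) = r + (r + (j'' + j'')))"
    using 3 by auto
  obtain c where c: "with_shift r j i j' m = c # m" "c + Suc (i + j') = r + (r + (j + j))"
    using with_shift[of r j i j' m] 3(2) by auto
  show ?case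
  proof (intro conjI allI impI)
    show "length (update_tail i ((j # r # m) # ?es)) = length ((j # r # m) # ?es)"
      using IH(1) by simp
    fix k assume k: "k < length ((j # r # m) # ?es)"
    show "\<exists>j'' ra ma r'. ((j # r # m) # ?es) ! k = j'' # ra # ma \<and>
      update_tail i ((j # r # m) # ?es) ! k = r' # ma \<and>
      (Suc k < length ((j # r # m) # ?es) \<longrightarrow>
        r' + Suc ((if k = 0 then i else hd (((j # r # m) # ?es) ! (k - 1))) +
          hd (((j # r # m) # ?es) ! Suc k)) = ra + (ra + (j'' + j'')))"
    proof (cases k)
      case 0
      then show ?thesis using c by simp
    next
      case (Suc k')
      have "((j # r # m) # ?es) ! (k - 1) = (if k' = 0 then j # r # m else ?es ! (k' - 1))"
        using Suc by (cases k') simp_all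
      with IH(2)[of k'] Suc k show ?thesis by (auto split: if_splits)
    qed
  qed
qed auto

lemma update:
  assumes "[] \<notin> set (update es)"
  shows "length (update es) = length es \<and>
    (\<forall>k<length es. \<exists>j r m r'. es ! k = j # r # m \<and> update es ! k = r' # m \<and>
      (0 < k \<and> Suc k < length es \<longrightarrow>
        r' + Suc (hd (es ! (k - 1)) + hd (es ! Suc k)) = r + (r + (j + j))))"
proof -
  obtain j r m es' where es: "es = (j # r # m) # es'"
    using assms by (cases es rule: update.cases) auto
  have tail: "length (update_tail j es') = length es'"
    "\<And>k. k < length es' \<Longrightarrow> \<exists>j'' r m r'. es' ! k = j'' # r # m \<and> update_tail j es' ! k = r' # m \<and>
      (Suc k < length es' \<longrightarrow>
        r' + Suc ((if k = 0 then j else hd (es' ! (k - 1))) + hd (es' ! Suc k)) = r + (r + (j'' + j'')))"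
    using update_tail[of j es'] assms es by auto
  show ?thesis
  proof (intro conjI allI impI)
    show "length (update es) = length es" using tail es by simp
    fix k assume k: "k < length es"
    show "\<exists>j r m r'. es ! k = j # r # m \<and> update es ! k = r' # m \<and>
      (0 < k \<and> Suc k < length es \<longrightarrow>
        r' + Suc (hd (es ! (k - 1)) + hd (es ! Suc k)) = r + (r + (j + j)))"
    proof (cases k)
      case 0
      then show ?thesis using es by simp
    next
      case (Suc k')
      have "es ! (k - 1) = (if k' = 0 then j # r # m else es' ! (k' - 1))"
        using Suc es by (cases k') simp_all
      with tail(2)[of k'] Suc k es show ?thesis by (auto split: if_splits)
    qed
  qed
qed

lemma update_failure: "[] \<in> set es \<or> es = [] \<Longrightarrow> [] \<in> set (update es)"
proof (rule ccontr)
  assume "[] \<in> set es \<or> es = []" and *: "[] \<notin> set (update es)"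
  then have "es \<noteq> []" by auto
  with \<open>[] \<in> set es \<or> es = []\<close> obtain k where "k < length es" "es ! k = []"
    by (auto simp: in_set_conv_nth)
  with update[OF *] show False by auto
qed

text \<open>Read backwards, a successful run shows that no intermediate state contains
  \<open>[]\<close>; this is how the success hypotheses of the single steps are obtained.\<close>

lemma run_failure: "[] \<in> set st \<or> st = [] \<Longrightarrow> \<not> run t p sched st"
proof (induction t p sched st rule: run.induct)
  case (1 t p st)
  then show ?case using final_failure by simp
next
  case (2 t p q G sched st)
  then show ?case using L_entries_failure update_failure by simp
qed

section \<open>Soundness of the rounded iteration\<close>

text \<open>A sequence vanishing outside \<open>1..n\<close> keeps doing so under this operator, so
  the bounds carried by \<open>L_op\<close> can be forgotten. The value at 0 is set explicitly
  because \<open>k - 1\<close> is truncated there.\<close>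

definition L_nat :: "(nat \<Rightarrow> real) \<Rightarrow> nat \<Rightarrow> real" where
  "L_nat x k = (if k = 0 then 0 else (x k)\<^sup>2 - x (k - 1) * x (k + 1))"

lemma L_nat_support:
  assumes "\<And>k. k = 0 \<or> n < k \<Longrightarrow> x k = 0" "k = 0 \<or> n < k"
  shows "(L_nat ^^ s) x k = 0"
  using assms(2)
proof (induction s arbitrary: k)
  case (Suc s)
  then show ?case by (auto simp: L_nat_def)
qed (use assms in simp)

lemma zero_ext_L_op_power:
  "zero_ext 1 (int n) ((L_op 1 (int n) ^^ s) a) (int k) =
    (L_nat ^^ s) (\<lambda>k. zero_ext 1 (int n) a (int k)) k"
proof (induction s arbitrary: k)
  case (Suc s)
  let ?x = "\<lambda>k. zero_ext 1 (int n) a (int k)"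
  show ?case
  proof (cases "1 \<le> k \<and> k \<le> n")
    case True
    then have "int k - 1 = int (k - 1)" "int k + 1 = int (k + 1)" by auto
    then have "L_op 1 (int n) ((L_op 1 (int n) ^^ s) a) (int k) =
        ((L_nat ^^ s) ?x k)\<^sup>2 - (L_nat ^^ s) ?x (k - 1) * (L_nat ^^ s) ?x (k + 1)"
      by (simp only: L_op_def[of _ _ "(L_op 1 (int n) ^^ s) a"] Suc)
    then show ?thesis using True by (simp add: zero_ext_def L_nat_def[of "(L_nat ^^ s) _"])
  next
    case False
    then have "(L_nat ^^ Suc s) ?x k = 0"
      by (intro L_nat_support[of n]) (auto simp: zero_ext_def)
    with False show ?thesis by (auto simp: zero_ext_def)
  qed
qed simp

lemma infinite_logconcaveI:
  assumes "\<And>s k. 1 \<le> k \<Longrightarrow> k \<le> n \<Longrightarrow> 0 < (L_nat ^^ s) (\<lambda>k. zero_ext 1 (int n) a (int k)) k"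
  shows "infinite_logconcave 1 (int n) a"
  unfolding infinite_logconcave_def logconcave_order_def
proof (intro allI impI ballI)
  fix s :: nat and j :: int
  assume j: "j \<in> {1..int n}"
  define k where "k = nat j"
  have k: "j = int k" "1 \<le> k" "k \<le> n" using j by (auto simp: k_def)
  show "(L_op 1 (int n) ^^ s) a j > 0"
    using assms[OF k(2,3), of s] zero_ext_L_op_power[of n s a k] j k by (simp add: zero_ext_def)
qed

text \<open>The square of the golden ratio is the least factor for which this condition is inherited by
  \<open>L_nat x\<close> (McNamara and Sagan).\<close>

lemma L_nat_positive_of_golden:
  fixes x :: "nat \<Rightarrow> real"
  defines "\<phi> \<equiv> (1 + sqrt 5) / 2"
  assumes "\<And>k. 0 \<le> x k" "\<And>k. k \<in> A \<Longrightarrow> 0 < x k" "0 \<notin> A"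
    and "\<And>k. 0 < k \<Longrightarrow> \<phi>\<^sup>2 * (x (k - 1) * x (k + 1)) \<le> (x k)\<^sup>2"
  shows "k \<in> A \<Longrightarrow> 0 < (L_nat ^^ s) x k"
proof -
  have phi: "\<phi>\<^sup>2 = \<phi> + 1" "1 < \<phi>"
    by (simp_all add: \<phi>_def power_divide power2_sum)
  have "(\<forall>k. 0 \<le> (L_nat ^^ s) x k) \<and> (\<forall>k\<in>A. 0 < (L_nat ^^ s) x k) \<and> (\<forall>k>0.
    \<phi>\<^sup>2 * ((L_nat ^^ s) x (k - 1) * (L_nat ^^ s) x (k + 1)) \<le> ((L_nat ^^ s) x k)\<^sup>2)"
  proof (induction s)
    case 0
    then show ?case using assms by auto
  next
    case (Suc s)
    define y where "y = (L_nat ^^ s) x"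
    have y: "\<And>k. 0 \<le> y k" "\<And>k. k \<in> A \<Longrightarrow> 0 < y k"
      "\<And>k. 0 < k \<Longrightarrow> \<phi>\<^sup>2 * (y (k - 1) * y (k + 1)) \<le> (y k)\<^sup>2"
      using Suc by (auto simp: y_def)
    \<comment> \<open>Removing one copy of the product leaves the factor
      \<open>\<phi>\<^sup>2 - 1 = \<phi>\<close>. Its square is the factor required for
      \<open>L_nat y\<close>, whose neighbouring entries are at most the squares of those of
      \<open>y\<close>.\<close>
    have gap: "\<phi> * (y (k - 1) * y (k + 1)) \<le> L_nat y k" if "0 < k" for k
      using y(3)[OF that] that phi by (simp add: L_nat_def algebra_simps)
    have upper: "L_nat y k \<le> (y k)\<^sup>2" for k
      using y(1) by (simp add: L_nat_def)
    have nonneg: "0 \<le> L_nat y k" for k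
    proof (cases "k = 0")
      case False
      have "0 \<le> \<phi> * (y (k - 1) * y (k + 1))" using y(1) phi by simp
      with gap[of k] False show ?thesis by linarith
    qed (simp add: L_nat_def)
    have positive: "0 < L_nat y k" if "k \<in> A" for k
    proof -
      have k: "0 < k" using that assms(4) by (cases k) auto
      have "y (k - 1) * y (k + 1) \<le> (y k)\<^sup>2 / \<phi>\<^sup>2"
        using y(3)[OF k] phi by (simp add: field_simps)
      also have "\<dots> < (y k)\<^sup>2" using y(2)[OF that] phi by (simp add: field_simps)
      finally show ?thesis using k by (simp add: L_nat_def)
    qed
    have "\<phi>\<^sup>2 * (L_nat y (k - 1) * L_nat y (k + 1)) \<le> (L_nat y k)\<^sup>2" if "0 < k" for k
    proof -
      have "L_nat y (k - 1) * L_nat y (k + 1) \<le> (y (k - 1))\<^sup>2 * (y (k + 1))\<^sup>2"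
        using upper nonneg y by (intro mult_mono) auto
      then have "\<phi>\<^sup>2 * (L_nat y (k - 1) * L_nat y (k + 1)) \<le> (\<phi> * (y (k - 1) * y (k + 1)))\<^sup>2"
        using phi by (simp add: power_mult_distrib)
      also have "\<dots> \<le> (L_nat y k)\<^sup>2"
        using gap[OF that] y(1) phi by (intro power_mono) auto
      finally show ?thesis .
    qed
    then show ?case using nonneg positive by (auto simp: y_def)
  qed
  then show "k \<in> A \<Longrightarrow> 0 < (L_nat ^^ s) x k" by blast
qed

section \<open>Floating-point approximation and its error in one step\<close>

definition mantissa :: "nat list list \<Rightarrow> nat \<Rightarrow> nat list" where
  "mantissa st k = (if 1 \<le> k \<and> k \<le> length st then tl (st ! (k - 1)) else [])"

definition exponent :: "nat list list \<Rightarrow> nat \<Rightarrow> nat" where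
  "exponent st k = hd (st ! (k - 1))"

text \<open>The mantissas determine \<open>x\<close> only up to the unknown weights \<open>w\<close>; of these just the
  ratios \<open>w (k - 1) * w (k + 1) / (w k)\<^sup>2\<close> enter into the iteration.\<close>

definition approximates :: "real \<Rightarrow> nat \<Rightarrow> (nat \<Rightarrow> real) \<Rightarrow> nat list list \<Rightarrow> bool" where
  "approximates e p x st \<longleftrightarrow> (\<forall>k. k = 0 \<or> length st < k \<longrightarrow> x k = 0) \<and>
    (\<forall>k\<in>{1..length st}. octal (mantissa st k) \<and> length (mantissa st k) = p \<and>
      8 ^ p \<le> 8 * oval (mantissa st k)) \<and>
    (\<exists>w :: nat \<Rightarrow> real. (\<forall>k. 0 < w k) \<and>
      (\<forall>k\<in>{1..length st}. \<bar>x k - w k * oval (mantissa st k)\<bar> \<le> e * (w k * oval (mantissa st k))) \<and>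
      (\<forall>k. 1 < k \<and> k < length st \<longrightarrow>
        8 * (w k)\<^sup>2 = 8 ^ exponent st k * (w (k - 1) * w (k + 1))))"

lemma approximates_positive:
  assumes "approximates e p x st" "e < 1" "1 \<le> k" "k \<le> length st"
  shows "0 < x k"
proof -
  obtain w :: "nat \<Rightarrow> real" where w: "\<forall>k. 0 < w k"
    "\<bar>x k - w k * oval (mantissa st k)\<bar> \<le> e * (w k * oval (mantissa st k))"
    using assms unfolding approximates_def by auto
  have "(8::nat) ^ p \<le> 8 * oval (mantissa st k)" using assms unfolding approximates_def by auto
  moreover have "(0::nat) < 8 ^ p" by simp
  ultimately have "0 < oval (mantissa st k)" by linarith
  then have "0 < w k * oval (mantissa st k)" using w(1) by simp
  then have "e * (w k * oval (mantissa st k)) < 1 * (w k * oval (mantissa st k))"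
    using assms by (intro mult_strict_right_mono) auto
  with w(2) show ?thesis by linarith
qed

lemma product_error:
  fixes a b x y e :: real
  assumes "\<bar>x - a\<bar> \<le> e * a" "\<bar>y - b\<bar> \<le> e * b" "0 \<le> a" "0 \<le> b" "0 \<le> e"
  shows "\<bar>x * y - a * b\<bar> \<le> (2 * e + e\<^sup>2) * (a * b)"
proof -
  have "x * y - a * b = (x - a) * (y - b) + a * (y - b) + (x - a) * b"
    by (simp add: algebra_simps)
  also have "\<bar>\<dots>\<bar> \<le> \<bar>x - a\<bar> * \<bar>y - b\<bar> + a * \<bar>y - b\<bar> + \<bar>x - a\<bar> * b"
    using assms by (auto simp: abs_mult intro!: order.trans[OF abs_triangle_ineq] add_mono)
  also have "\<dots> \<le> (e * a) * (e * b) + a * (e * b) + (e * a) * b"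
    using assms by (intro add_mono mult_mono) auto
  finally show ?thesis by (simp add: algebra_simps power2_eq_square)
qed

text \<open>Here \<open>a\<^sup>2\<close> and \<open>\<theta>\<close> approximate \<open>(x k)\<^sup>2\<close> and \<open>x (k - 1) * x (k + 1)\<close>, both divided by
  \<open>(w k)\<^sup>2\<close>, and \<open>t * u\<close> is the truncation of \<open>a\<^sup>2 - \<theta>\<close> with last place \<open>u\<close>.\<close>

lemma step_error:
  fixes x y z w a t \<theta> e g u v :: real
  assumes x: "\<bar>x - w * a\<bar> \<le> e * (w * a)" and yz: "\<bar>y * z - w\<^sup>2 * \<theta>\<bar> \<le> (2 * e + e\<^sup>2) * (w\<^sup>2 * \<theta>)"
    and "0 < w" "0 < a" "0 \<le> \<theta>" and e: "0 \<le> e" "e \<le> 1 / 50" and "0 < u" "0 < t"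
    and lo: "t * u + \<theta> < a\<^sup>2 + u" and hi: "a\<^sup>2 < t * u + u + \<theta>" and \<theta>: "\<theta> \<le> a\<^sup>2"
    and small: "a\<^sup>2 < g * t * u" and v: "1 \<le> t * v"
  shows "\<bar>x\<^sup>2 - y * z - w\<^sup>2 * u * t\<bar> \<le> (2 * g * (202 / 100 * e) + v) * (w\<^sup>2 * u * t)"
proof -
  define \<eta> where "\<eta> = 202 / 100 * e"
  have "e * e \<le> 1 / 50 * e" using e by (intro mult_right_mono)
  then have \<eta>: "2 * e + e\<^sup>2 \<le> \<eta>" "0 \<le> \<eta>" "0 \<le> 2 * e + e\<^sup>2"
    using e by (auto simp: power2_eq_square \<eta>_def)
  have wa: "0 \<le> w\<^sup>2 * a\<^sup>2" "0 \<le> w * a" using \<open>0 < w\<close> \<open>0 < a\<close> by simp_all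
  have "\<bar>x * x - (w * a) * (w * a)\<bar> \<le> (2 * e + e\<^sup>2) * ((w * a) * (w * a))"
    using x e wa by (intro product_error)
  moreover have "(w * a) * (w * a) = w\<^sup>2 * a\<^sup>2" by (simp add: power2_eq_square)
  ultimately have "\<bar>x\<^sup>2 - w\<^sup>2 * a\<^sup>2\<bar> \<le> (2 * e + e\<^sup>2) * (w\<^sup>2 * a\<^sup>2)"
    by (simp add: power2_eq_square)
  also have "\<dots> \<le> \<eta> * (w\<^sup>2 * a\<^sup>2)" using \<eta>(1) wa(1) by (rule mult_right_mono)
  finally have 1: "\<bar>x\<^sup>2 - w\<^sup>2 * a\<^sup>2\<bar> \<le> \<eta> * (w\<^sup>2 * a\<^sup>2)" .
  have "w\<^sup>2 * \<theta> \<le> w\<^sup>2 * a\<^sup>2" using \<theta> by (intro mult_left_mono) auto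
  then have "(2 * e + e\<^sup>2) * (w\<^sup>2 * \<theta>) \<le> \<eta> * (w\<^sup>2 * a\<^sup>2)"
    using \<eta> \<open>0 \<le> \<theta>\<close> by (intro mult_mono[OF \<eta>(1)]) auto
  with yz have 2: "\<bar>y * z - w\<^sup>2 * \<theta>\<bar> \<le> \<eta> * (w\<^sup>2 * a\<^sup>2)" by (rule order.trans)
  \<comment> \<open>Truncation costs at most one unit \<open>u\<close>, which relative to
    \<open>t * u\<close> is at most \<open>v\<close>.\<close>
  have "w\<^sup>2 * a\<^sup>2 - w\<^sup>2 * \<theta> - w\<^sup>2 * u * t = w\<^sup>2 * (a\<^sup>2 - \<theta> - t * u)" by (simp add: algebra_simps)
  also have "\<bar>\<dots>\<bar> = w\<^sup>2 * \<bar>a\<^sup>2 - \<theta> - t * u\<bar>" by (simp add: abs_mult)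
  also have "\<dots> \<le> w\<^sup>2 * u" using lo hi by (intro mult_left_mono) auto
  finally have "\<bar>w\<^sup>2 * a\<^sup>2 - w\<^sup>2 * \<theta> - w\<^sup>2 * u * t\<bar> \<le> w\<^sup>2 * u" .
  moreover have "w\<^sup>2 * u * 1 \<le> w\<^sup>2 * u * (t * v)"
    using v \<open>0 < u\<close> by (intro mult_left_mono) auto
  ultimately have 3: "\<bar>w\<^sup>2 * a\<^sup>2 - w\<^sup>2 * \<theta> - w\<^sup>2 * u * t\<bar> \<le> v * (w\<^sup>2 * u * t)"
    by (simp add: mult_ac)
  \<comment> \<open>The cancellation bound turns errors relative to the square into errors relative
    to the difference.\<close>
  have "w\<^sup>2 * a\<^sup>2 \<le> w\<^sup>2 * (g * t * u)" using small by (intro mult_left_mono) auto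
  then have "\<eta> * (w\<^sup>2 * a\<^sup>2) \<le> \<eta> * (w\<^sup>2 * (g * t * u))"
    using \<eta>(2) by (rule mult_left_mono)
  also have "\<dots> = g * \<eta> * (w\<^sup>2 * u * t)" by (simp only: mult_ac)
  finally have 4: "\<eta> * (w\<^sup>2 * a\<^sup>2) \<le> g * \<eta> * (w\<^sup>2 * u * t)" .
  have "(2 * g * \<eta> + v) * (w\<^sup>2 * u * t) = 2 * (g * \<eta> * (w\<^sup>2 * u * t)) + v * (w\<^sup>2 * u * t)"
    by (simp add: algebra_simps)
  moreover have "\<bar>x\<^sup>2 - y * z - w\<^sup>2 * u * t\<bar> \<le> \<bar>x\<^sup>2 - w\<^sup>2 * a\<^sup>2\<bar> + \<bar>y * z - w\<^sup>2 * \<theta>\<bar>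
      + \<bar>w\<^sup>2 * a\<^sup>2 - w\<^sup>2 * \<theta> - w\<^sup>2 * u * t\<bar>" by linarith
  ultimately show ?thesis using 1 2 3 4 unfolding \<eta>_def by linarith
qed

text \<open>The new weights are \<open>w' k = (w k)\<^sup>2 * 8 ^ J k\<close>: the operator is
  quadratic, and \<open>8 ^ J k\<close> is the place value of the last digit kept. The error bound
  is \<open>step_error\<close> in units of \<open>(w k)\<^sup>2\<close>.\<close>

lemma approximates_L_nat:
  assumes ap: "approximates e p x st" and e: "0 \<le> e" "e \<le> 1 / 50"
    and q: "0 < q" "q \<le> 2 * p" and G: "octal G"
    and ok: "[] \<notin> set (update (L_entries G q (2 * p - q) [] st))" and st: "[] \<notin> set st" "st \<noteq> []"
  shows "approximates (2 * real (oval G) * (202 / 100 * e) + 8 / 8 ^ q) q (L_nat x)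
    (update (L_entries G q (2 * p - q) [] st))"
proof -
  define n es st' e' where "n = length st" and "es = L_entries G q (2 * p - q) [] st"
    and "st' = update es" and "e' = 2 * real (oval G) * (202 / 100 * e) + 8 / 8 ^ q"
  obtain w :: "nat \<Rightarrow> real" where w: "\<And>k. 0 < w k"
    "\<And>k. k \<in> {1..n} \<Longrightarrow> \<bar>x k - w k * oval (mantissa st k)\<bar> \<le> e * (w k * oval (mantissa st k))"
    "\<And>k. 1 < k \<Longrightarrow> k < n \<Longrightarrow> 8 * (w k)\<^sup>2 = 8 ^ exponent st k * (w (k - 1) * w (k + 1))"
    using ap unfolding approximates_def n_def by blast
  have x0: "\<And>k. k = 0 \<or> n < k \<Longrightarrow> x k = 0"
    and m: "\<And>k. k \<in> {1..n} \<Longrightarrow> octal (mantissa st k) \<and> length (mantissa st k) = p \<and>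
      8 ^ p \<le> 8 * oval (mantissa st k)"
    using ap unfolding approximates_def n_def by auto
  have m0: "mantissa st k = []" if "k \<notin> {1..n}" for k
    using that by (auto simp: mantissa_def n_def)
  have oct: "octal (mantissa st k)" for k using m m0 by (cases "k \<in> {1..n}") auto
  have nth: "length es = n" "\<And>i. i < n \<Longrightarrow> es ! i =
      L_entry G q (2 * p - q) (hd (st ! i)) (if i = 0 then [] else tl (st ! (i - 1))) (tl (st ! i))
        (if Suc i < n then tl (st ! Suc i) else [])"
    using L_entries_nth[OF st, of G q "2 * p - q" "[]"] by (auto simp: es_def n_def)
  have es: "es ! (k - 1) =
      L_entry G q (2 * p - q) (exponent st k) (mantissa st (k - 1)) (mantissa st k) (mantissa st (k + 1))"
    if "k \<in> {1..n}" for k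
    using nth(1) nth(2)[of "k - 1"] that st(2) by (auto simp: n_def exponent_def mantissa_def)
  have st': "length st' = n" "\<And>i. i < n \<Longrightarrow> \<exists>j r m r'. es ! i = j # r # m \<and> st' ! i = r' # m \<and>
      (0 < i \<and> Suc i < n \<longrightarrow> r' + Suc (hd (es ! (i - 1)) + hd (es ! Suc i)) = r + (r + (j + j)))"
    using update[of es] ok nth(1) by (auto simp: st'_def es_def)
  define J where "J k = hd (es ! (k - 1))" for k
  have entry: "L_entry G q (2 * p - q) (exponent st k) (mantissa st (k - 1)) (mantissa st k)
      (mantissa st (k + 1)) = J k # exponent st k # mantissa st' k
    \<and> octal (mantissa st' k) \<and> length (mantissa st' k) = q
    \<and> 8 ^ q \<le> 8 * oval (mantissa st' k)
    \<and> (oval (mantissa st k))\<^sup>2 < oval G * oval (mantissa st' k) * 8 ^ J k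
    \<and> oval (mantissa st' k) * 8 ^ J k
        + 8 * (oval (mantissa st (k - 1)) * oval (mantissa st (k + 1))) div 8 ^ exponent st k
      \<le> (oval (mantissa st k))\<^sup>2
    \<and> (oval (mantissa st k))\<^sup>2 < (oval (mantissa st' k) + 1) * 8 ^ J k
        + 8 * (oval (mantissa st (k - 1)) * oval (mantissa st (k + 1))) div 8 ^ exponent st k"
    if k: "k \<in> {1..n}" for k
  proof -
    have k': "k - 1 < n" using k by auto
    obtain j r m1 r' where *: "es ! (k - 1) = j # r # m1" "st' ! (k - 1) = r' # m1"
      using st'(2)[OF k'] by blast
    have "mantissa st' k = m1" using * k st'(1) by (auto simp: mantissa_def)
    moreover have "J k = j" using * by (simp add: J_def)
    ultimately have eq: "L_entry G q (2 * p - q) (exponent st k) (mantissa st (k - 1)) (mantissa st k)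
        (mantissa st (k + 1)) = J k # r # mantissa st' k"
      using * es[OF k] by simp
    have "length (mantissa st k) = p" "8 ^ p \<le> 8 * oval (mantissa st k)" using m[OF k] by simp_all
    from L_entry[OF G oct[of "k - 1"] oct[of k] oct[of "k + 1"] this(1) q this(2), of "exponent st k",
        unfolded eq, OF list.distinct(2)]
    show ?thesis unfolding eq by (elim exE conjE) (simp del: One_nat_def)
  qed
  have shift: "exponent st' k + Suc (J (k - 1) + J (k + 1)) =
      exponent st k + (exponent st k + (J k + J k))" if k: "1 < k" "k < n" for k
  proof -
    have k': "k - 1 < n" "0 < k - 1" "Suc (k - 1) = k" "k \<in> {1..n}" using k by auto
    obtain j r m1 r' where *: "es ! (k - 1) = j # r # m1" "st' ! (k - 1) = r' # m1"
      "r' + Suc (hd (es ! (k - 1 - 1)) + hd (es ! k)) = r + (r + (j + j))"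
      using st'(2)[OF k'(1)] k k' by auto
    moreover have "r = exponent st k" using entry[OF k'(4)] es[OF k'(4)] * by simp
    ultimately show ?thesis by (simp add: J_def exponent_def)
  qed
  define w' where "w' k = (w k)\<^sup>2 * 8 ^ J k" for k
  have "approximates e' q (L_nat x) st'"
    unfolding approximates_def st'(1)
  proof (intro conjI ballI exI[of _ w'] allI impI)
    fix k assume "k = 0 \<or> n < k"
    then show "L_nat x k = 0" using x0 by (auto simp: L_nat_def)
  next
    fix k assume k: "k \<in> {1..n}"
    from entry[OF k] show "octal (mantissa st' k)" "length (mantissa st' k) = q"
      "8 ^ q \<le> 8 * oval (mantissa st' k)" by auto
  next
    fix k show "0 < w' k" using w(1)[of k] by (simp add: w'_def)
  next
    \<comment> \<open>The new exponent follows by squaring the old weight relation at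
      \<open>k\<close> and inserting the shifts; the \<open>Suc\<close> in the recurrence comes from
      squaring the bias 8.\<close>
    fix k assume k: "1 < k \<and> k < n"
    define r where "r = exponent st k"
    have "8 * (w k)\<^sup>2 = 8 ^ r * (w (k - 1) * w (k + 1))" using w(3) k by (simp add: r_def)
    then have "(8 * (w k)\<^sup>2)\<^sup>2 = (8 ^ r * (w (k - 1) * w (k + 1)))\<^sup>2" by simp
    then have W: "64 * ((w k)\<^sup>2)\<^sup>2 = 8 ^ r * 8 ^ r * ((w (k - 1))\<^sup>2 * (w (k + 1))\<^sup>2)"
      by (simp add: power_mult_distrib power2_eq_square mult_ac)
    have "exponent st' k + Suc (J (k - 1) + J (k + 1)) = r + (r + (J k + J k))"
      using shift[of k] k by (simp add: r_def)
    then have "8 ^ (exponent st' k + Suc (J (k - 1) + J (k + 1))) = (8 :: real) ^ (r + (r + (J k + J k)))"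
      by simp
    then have E: "8 ^ exponent st' k * (8 * (8 ^ J (k - 1) * 8 ^ J (k + 1))) =
        8 ^ r * 8 ^ r * ((8 :: real) ^ J k * 8 ^ J k)"
      by (simp only: power_add power_Suc mult_ac)
    have "8 ^ r * 8 ^ r * (8 * (w' k)\<^sup>2) = 8 * ((w k)\<^sup>2)\<^sup>2 * (8 ^ r * 8 ^ r * (8 ^ J k * 8 ^ J k))"
      by (simp add: w'_def power2_eq_square)
    also have "\<dots> = 64 * ((w k)\<^sup>2)\<^sup>2 * (8 ^ exponent st' k * (8 ^ J (k - 1) * 8 ^ J (k + 1)))"
      by (simp add: E[symmetric])
    also have "\<dots> = 8 ^ r * 8 ^ r * (8 ^ exponent st' k * (w' (k - 1) * w' (k + 1)))"
      unfolding W by (simp add: w'_def)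
    finally show "8 * (w' k)\<^sup>2 = 8 ^ exponent st' k * (w' (k - 1) * w' (k + 1))" by simp
  next
    fix k assume k: "k \<in> {1..n}"
    define r a t where "r = exponent st k" and "a = oval (mantissa st k)" and "t = oval (mantissa st' k)"
    define T where "T = oval (mantissa st (k - 1)) * oval (mantissa st (k + 1))"
    define \<theta> where "\<theta> = 8 * real T / 8 ^ r"
    define u where "u = (8 :: real) ^ J k"
    define d where "d = 8 * T div 8 ^ r"
    have nat: "a\<^sup>2 < oval G * t * 8 ^ J k" "t * 8 ^ J k + d \<le> a\<^sup>2" "a\<^sup>2 < (t + 1) * 8 ^ J k + d"
      "8 ^ q \<le> 8 * t" "8 ^ p \<le> 8 * a"
      using entry[OF k] m[OF k] unfolding a_def t_def T_def r_def d_def by blast+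
    \<comment> \<open>The computation only sees the integer part \<open>d\<close> of
      \<open>\<theta>\<close>. The lost fraction is below 1 and hence below the unit
      \<open>u\<close>, so it fits into the truncation error.\<close>
    have floor: "real d \<le> \<theta>" "\<theta> < real d + 1"
    proof -
      have "real (8 * T) = real (d * 8 ^ r + 8 * T mod 8 ^ r)"
        unfolding d_def by (simp only: div_mult_mod_eq)
      then have *: "8 * real T = real d * 8 ^ r + real (8 * T mod 8 ^ r)"
        by (simp only: of_nat_add of_nat_mult of_nat_power of_nat_numeral)
      have "8 * T mod 8 ^ r < 8 ^ r" by simp
      then have "real (8 * T mod 8 ^ r) < real (8 ^ r)" by (simp only: of_nat_less_iff)
      then have **: "real (8 * T mod 8 ^ r) < 8 ^ r" by (simp only: of_nat_power of_nat_numeral)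
      have pos: "(0 :: real) < 8 ^ r" by simp
      show "real d \<le> \<theta>"
        unfolding \<theta>_def * using pos by (simp only: le_divide_eq if_True)
      show "\<theta> < real d + 1"
        unfolding \<theta>_def * using pos ** by (simp only: divide_less_eq if_True distrib_right mult_1 add_less_cancel_left)
    qed
    have u1: "1 \<le> u" by (simp add: u_def)
    have pos: "0 < t" "0 < a"
    proof -
      have "(0::nat) < 8 ^ q" "(0::nat) < 8 ^ p" by simp_all
      then show "0 < t" "0 < a" using nat(4,5) by linarith+
    qed
    have "real (a\<^sup>2) < real (oval G * t * 8 ^ J k)" using nat(1) by (simp only: of_nat_less_iff)
    then have R1: "(real a)\<^sup>2 < oval G * t * u" by (simp add: u_def)
    have "real (t * 8 ^ J k + d) \<le> real (a\<^sup>2)" using nat(2) by (simp only: of_nat_le_iff)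
    then have R2: "real t * u + d \<le> (real a)\<^sup>2" by (simp add: u_def)
    have "real (a\<^sup>2 + 1) \<le> real ((t + 1) * 8 ^ J k + d)" using nat(3) by (simp only: of_nat_le_iff)
    then have R3: "(real a)\<^sup>2 + 1 \<le> real t * u + u + d" by (simp add: u_def algebra_simps)
    have "1 * 1 \<le> real t * u" using u1 pos by (intro mult_mono) auto
    then have tu: "1 \<le> real t * u" by simp
    have yz: "\<bar>x (k - 1) * x (k + 1) - (w k)\<^sup>2 * \<theta>\<bar> \<le> (2 * e + e\<^sup>2) * ((w k)\<^sup>2 * \<theta>)"
    proof (cases "1 < k \<and> k < n")
      case True
      have "8 * (w k)\<^sup>2 = 8 ^ r * (w (k - 1) * w (k + 1))" using w(3) True by (simp add: r_def)
      then have "(w k)\<^sup>2 * \<theta> = w (k - 1) * w (k + 1) * T" by (simp add: \<theta>_def field_simps)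
      also have "\<dots> = (w (k - 1) * oval (mantissa st (k - 1))) * (w (k + 1) * oval (mantissa st (k + 1)))"
        by (simp add: T_def)
      finally have *: "(w k)\<^sup>2 * \<theta> = \<dots>" .
      have "k - 1 \<in> {1..n}" "k + 1 \<in> {1..n}" using True by auto
      from product_error[OF w(2)[OF this(1)] w(2)[OF this(2)]] e(1) show ?thesis
        unfolding * using w(1)[of "k - 1"] w(1)[of "k + 1"] by simp
    next
      case False
      \<comment> \<open>At an end of the row one neighbour is zero, exactly and in the
        approximation, so the dummy exponent has no effect.\<close>
      then have "k - 1 \<notin> {1..n} \<or> k + 1 \<notin> {1..n}" using k by auto
      then have "T = 0" "x (k - 1) * x (k + 1) = 0"
        using m0[of "k - 1"] m0[of "k + 1"] x0[of "k - 1"] x0[of "k + 1"] by (auto simp: T_def)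
      then show ?thesis by (simp add: \<theta>_def)
    qed
    have "\<bar>(x k)\<^sup>2 - x (k - 1) * x (k + 1) - (w k)\<^sup>2 * u * t\<bar>
        \<le> (2 * real (oval G) * (202 / 100 * e) + 8 / 8 ^ q) * ((w k)\<^sup>2 * u * t)"
    proof (rule step_error[OF _ yz w(1)])
      show "\<bar>x k - w k * real a\<bar> \<le> e * (w k * real a)" using w(2)[OF k] by (simp add: a_def)
      show "0 < real a" "0 < real t" "0 < u" using pos u1 by auto
      show "0 \<le> \<theta>" by (simp add: \<theta>_def)
      show "real t * u + \<theta> < (real a)\<^sup>2 + u" using R2 floor u1 by linarith
      show "(real a)\<^sup>2 < real t * u + u + \<theta>" using R3 floor by linarith
      show "\<theta> \<le> (real a)\<^sup>2" using R2 floor tu by linarith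
      show "(real a)\<^sup>2 < real (oval G) * real t * u" using R1 by simp
      have "real (8 ^ q) \<le> real (8 * t)" using nat(4) by (simp only: of_nat_le_iff)
      then show "1 \<le> real t * (8 / 8 ^ q)" by (simp add: field_simps)
    qed (use e in auto)
    then show "\<bar>L_nat x k - w' k * real (oval (mantissa st' k))\<bar>
        \<le> e' * (w' k * real (oval (mantissa st' k)))"
      using k by (simp add: L_nat_def w'_def u_def t_def e'_def)
  qed
  then show ?thesis by (simp add: e'_def st'_def es_def)
qed

section \<open>From the final test to positivity of all iterates\<close>

lemma final_nth:
  assumes "final t l st" "i < length st" "Suc i < length st"
  shows "final_test t (hd (st ! i)) (muladd (tl (st ! i)) (tl (st ! i)) [])
    (muladd (if i = 0 then l else tl (st ! (i - 1))) (tl (st ! Suc i)) [])"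
  using assms
proof (induction t l st arbitrary: i rule: final.induct)
  case (1 t l r m r' m' st)
  show ?case
  proof (cases i)
    case 0
    then show ?thesis using 1 by simp
  next
    case (Suc i')
    then show ?thesis using 1(1)[of i'] 1(2-4) by (cases i') auto
  qed
qed auto

lemma final_test:
  assumes "octal t" "octal S" "octal T" "final_test t r S T"
  shows "64 * (8 * real (oval T) / 8 ^ r) \<le> oval t * real (oval S)"
proof -
  have "oval (drop r (0 # 0 # 0 # T)) < oval (muladd t S [])"
    using assms below[of "drop r (0 # 0 # 0 # T)" "muladd t S []" False]
      muladd[of "[]" S t] octal_drop[of "0 # 0 # 0 # T" r] by (simp add: final_test_def)
  moreover have "oval (muladd t S []) = oval t * oval S"
    using muladd[of "[]" S t] assms by simp
  moreover have "oval (drop r (0 # 0 # 0 # T)) = 512 * oval T div 8 ^ r"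
    using oval_drop[of "0 # 0 # 0 # T" r] assms by simp
  ultimately have "512 * oval T < oval t * oval S * 8 ^ r"
    by (simp add: div_less_iff_less_mult)
  then have "real (512 * oval T) \<le> real (oval t * oval S * 8 ^ r)" by (simp only: of_nat_le_iff)
  then have "512 * real (oval T) \<le> oval t * real (oval S) * 8 ^ r" by simp
  then show ?thesis by (simp add: pos_divide_le_eq)
qed

text \<open>The test bounds the quotient of the rounded values by \<open>t / 64\<close>. Passing to
  the true values costs at most the factor \<open>(1 + e)\<^sup>2 / (1 - e)\<^sup>2\<close>, for
  which the numerical hypothesis leaves room below the golden threshold.\<close>

lemma final_positive:
  assumes ap: "approximates e p x st" and e: "0 \<le> e" "e < 1" and t: "octal t"
      "26181 / 10000 * (real (oval t) / 64) * (1 + e)\<^sup>2 \<le> (1 - e)\<^sup>2" and fin: "final t [] st"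
    and k: "1 \<le> k" "k \<le> length st"
  shows "0 < (L_nat ^^ s) x k"
proof -
  define n where "n = length st"
  define \<phi> where "\<phi> = (1 + sqrt 5) / 2"
  obtain w :: "nat \<Rightarrow> real" where w: "\<And>k. 0 < w k"
    "\<And>k. k \<in> {1..n} \<Longrightarrow> \<bar>x k - w k * oval (mantissa st k)\<bar> \<le> e * (w k * oval (mantissa st k))"
    "\<And>k. 1 < k \<Longrightarrow> k < n \<Longrightarrow> 8 * (w k)\<^sup>2 = 8 ^ exponent st k * (w (k - 1) * w (k + 1))"
    using ap unfolding approximates_def n_def by blast
  have x0: "\<And>k. k = 0 \<or> n < k \<Longrightarrow> x k = 0" and oct: "\<And>k. k \<in> {1..n} \<Longrightarrow> octal (mantissa st k)"
    using ap unfolding approximates_def n_def by auto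
  have pos: "0 < x k" if "k \<in> {1..n}" for k
    using approximates_positive[OF ap] e that by (auto simp: n_def)
  have nonneg: "0 \<le> x k" for k using pos[of k] x0[of k] by (cases "k \<in> {1..n}") auto
  have phi: "\<phi>\<^sup>2 \<le> 26181 / 10000"
  proof -
    \<comment> \<open>With \<open>\<phi>\<^sup>2 = (3 + sqrt 5) / 2\<close> this gives the bound
      2.61805.\<close>
    have "sqrt 5 \<le> 22361 / 10000" by (rule real_le_lsqrt) (simp_all add: power2_eq_square)
    then show ?thesis by (simp add: \<phi>_def power_divide power2_sum)
  qed
  have "\<phi>\<^sup>2 * (x (k - 1) * x (k + 1)) \<le> (x k)\<^sup>2" if "0 < k" for k
  proof (cases "1 < k \<and> k < n")
    case False
    then have "x (k - 1) = 0 \<or> x (k + 1) = 0" using x0 that by auto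
    then show ?thesis by auto
  next
    case True
    define r where "r = exponent st k"
    define a b c where "a = w k * oval (mantissa st k)" and "b = w (k - 1) * oval (mantissa st (k - 1))"
      and "c = w (k + 1) * oval (mantissa st (k + 1))"
    have nn: "0 \<le> a" "0 \<le> b" "0 \<le> c" using w(1) by (simp_all add: a_def b_def c_def less_imp_le)
    have in_range: "k \<in> {1..n}" "k - 1 \<in> {1..n}" "k + 1 \<in> {1..n}" using True by auto
    define S T where "S = oval (mantissa st k)" and
      "T = oval (mantissa st (k - 1)) * oval (mantissa st (k + 1))"
    have "final_test t r (muladd (mantissa st k) (mantissa st k) [])
        (muladd (mantissa st (k - 1)) (mantissa st (k + 1)) [])"
      using final_nth[OF fin, of "k - 1"] True by (auto simp: mantissa_def exponent_def n_def r_def)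
    from final_test[OF t(1) _ _ this] have "64 * (8 * real T / 8 ^ r) \<le> oval t * (real S)\<^sup>2"
      using muladd[of "[]"] oct in_range by (simp add: S_def T_def power2_eq_square)
    then have "64 * (8 * real T / 8 ^ r) * (w k)\<^sup>2 \<le> oval t * (real S)\<^sup>2 * (w k)\<^sup>2"
      by (intro mult_right_mono) auto
    moreover have "8 * real T / 8 ^ r * (w k)\<^sup>2 = b * c"
      using w(3)[of k] True by (simp add: b_def c_def T_def r_def field_simps)
    moreover have "(real S)\<^sup>2 * (w k)\<^sup>2 = a\<^sup>2"
      by (simp add: a_def S_def power_mult_distrib)
    ultimately have bc: "64 * (b * c) \<le> oval t * a\<^sup>2" by (simp add: mult.assoc)
    have bounds: "x (k - 1) \<le> (1 + e) * b" "x (k + 1) \<le> (1 + e) * c" "(1 - e) * a \<le> x k"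
      using w(2)[OF in_range(1)] w(2)[OF in_range(2)] w(2)[OF in_range(3)]
      unfolding a_def b_def c_def by (simp_all add: abs_le_iff algebra_simps)
    have le: "x (k - 1) * x (k + 1) \<le> ((1 + e) * b) * ((1 + e) * c)"
      using bounds nonneg nn e by (intro mult_mono) auto
    have "\<phi>\<^sup>2 * (x (k - 1) * x (k + 1)) \<le> 26181 / 10000 * (((1 + e) * b) * ((1 + e) * c))"
      by (rule mult_mono[OF phi le]) (use nonneg in auto)
    also have "\<dots> = 26181 / 10000 * (1 + e)\<^sup>2 / 64 * (64 * (b * c))"
      by (simp add: power2_eq_square)
    also have "\<dots> \<le> 26181 / 10000 * (1 + e)\<^sup>2 / 64 * (oval t * a\<^sup>2)"
      using bc by (intro mult_left_mono) auto
    also have "\<dots> = 26181 / 10000 * (real (oval t) / 64) * (1 + e)\<^sup>2 * a\<^sup>2" by simp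
    also have "\<dots> \<le> (1 - e)\<^sup>2 * a\<^sup>2" using t(2) by (intro mult_right_mono) auto
    also have "\<dots> = ((1 - e) * a)\<^sup>2" by (rule power_mult_distrib[symmetric])
    also have "\<dots> \<le> (x k)\<^sup>2" using bounds(3) nn e by (intro power_mono) auto
    finally show ?thesis .
  qed
  then show ?thesis
    using L_nat_positive_of_golden[of x "{1..n}" k s] nonneg pos k
    by (auto simp: \<phi>_def n_def)
qed

text \<open>The sequence itself is positive because its relative error is below 1; its later
  iterates are iterates of \<open>L_nat x\<close>, which the rest of the schedule covers. The golden
  condition thus enters only when the schedule is exhausted.\<close>

lemma run_positive:
  assumes "approximates e p x st" "0 \<le> e" "error_ok t e p sched" "run t p sched st"
    and "1 \<le> k" "k \<le> length st"
  shows "0 < (L_nat ^^ s) x k"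
  using assms
proof (induction t p sched st arbitrary: e x s rule: run.induct)
  case (1 t p st)
  then show ?case using final_positive[of e p x st t k s] by simp
next
  case (2 t p q G sched st)
  define st' where "st' = update (L_entries G q (2 * p - q) [] st)"
  have run: "run t q sched st'" using 2(5) by (simp add: st'_def mult_2)
  then have ok: "[] \<notin> set st'" using run_failure by blast
  have err: "e \<le> 1 / 50" "0 < q" "q \<le> 2 * p" "octal G"
      "error_ok t (2 * real (oval G) * (202 / 100 * e) + 8 / 8 ^ q) q sched"
    using 2(4) by simp_all
  have st: "[] \<notin> set st" "st \<noteq> []"
    using 2(5) run_failure by blast+
  have "approximates (2 * real (oval G) * (202 / 100 * e) + 8 / 8 ^ q) q (L_nat x) st'"
    unfolding st'_def using err ok[unfolded st'_def] by (intro approximates_L_nat[OF 2(2,3)] st) auto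
  moreover have "length st' = length st"
    using update[of "L_entries G q (2 * p - q) [] st"] ok L_entries_nth[OF st] by (simp add: st'_def)
  ultimately have IH: "0 < (L_nat ^^ s) (L_nat x) k" for s
    using 2(1)[folded mult_2, folded st'_def, OF _ _ err(5) run, of "L_nat x" s] 2(3,6,7) by simp
  show ?case
  proof (cases s)
    case 0
    then show ?thesis using approximates_positive[OF 2(2)] err(1) 2(6,7) by simp
  next
    case (Suc s')
    then show ?thesis using IH[of s'] by (simp add: funpow_Suc_right del: funpow.simps)
  qed
qed

section \<open>Rounding an integer row to the initial state\<close>

fun count_digits :: "nat \<Rightarrow> nat list \<Rightarrow> nat list \<Rightarrow> nat \<Rightarrow> nat list" where
  "count_digits p [] acc l = (if acc = [] \<or> hd acc = 0 \<or> l < p then [] else l # 1 # take_rev p acc [])"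
| "count_digits p (x # xs) acc l = count_digits p xs (x # acc) (Suc l)"

text \<open>The fictitious previous exponent 1 describes constant weights, as
  \<open>8 / 8 ^ 1 = 1\<close>. With the digit counts as shifts, \<open>update\<close> then produces
  the exponents belonging to the weights \<open>8 ^ l / 8 ^ p\<close>.\<close>

definition float_row :: "nat \<Rightarrow> nat list list \<Rightarrow> nat list list" where
  "float_row p vs = update (map (\<lambda>xs. count_digits p xs [] 0) vs)"

lemma count_digits:
  "count_digits p xs acc l = count_digits p [] (rev xs @ acc) (l + length xs)"
  by (induction xs arbitrary: acc l) auto

text \<open>With \<open>v\<close> the integer entry, \<open>a\<close> its mantissa and
  \<open>u\<close> the place value of the last digit kept, truncation loses less than
  \<open>u\<close>, and \<open>v \<le> 2 * a * u\<close> is where the factor 2 before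
  \<open>d\<close> comes from.\<close>

lemma float_row:
  fixes x :: "nat \<Rightarrow> real" and d :: real
  assumes ok: "[] \<notin> set (float_row p vs)"
    and x0: "\<And>k. k = 0 \<or> length vs < k \<Longrightarrow> x k = 0"
    and oct: "\<And>xs. xs \<in> set vs \<Longrightarrow> octal xs" and "0 < p" "0 \<le> d"
    and x: "\<And>k. k \<in> {1..length vs} \<Longrightarrow> oval (vs ! (k - 1)) \<le> x k \<and> x k \<le> (1 + d) * oval (vs ! (k - 1))"
  shows "approximates (2 * d + 8 / 8 ^ p) p x (float_row p vs)" and "length (float_row p vs) = length vs"
proof -
  define n es st where "n = length vs" and "es = map (\<lambda>xs. count_digits p xs [] 0) vs"
    and "st = update es"
  have st: "length st = n" "\<And>i. i < n \<Longrightarrow> \<exists>j r m r'. es ! i = j # r # m \<and> st ! i = r' # m \<and>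
      (0 < i \<and> Suc i < n \<longrightarrow> r' + Suc (hd (es ! (i - 1)) + hd (es ! Suc i)) = r + (r + (j + j)))"
    using update[of es] ok by (auto simp: float_row_def es_def st_def n_def)
  then show "length (float_row p vs) = length vs" by (simp add: float_row_def es_def st_def n_def)
  define J where "J k = hd (es ! (k - 1))" for k
  have entry: "es ! (k - 1) = J k # 1 # mantissa st k \<and> octal (mantissa st k) \<and> length (mantissa st k) = p
      \<and> 8 ^ p \<le> 8 * oval (mantissa st k) \<and> p \<le> J k
      \<and> oval (mantissa st k) * 8 ^ (J k - p) \<le> oval (vs ! (k - 1))
      \<and> oval (vs ! (k - 1)) < (oval (mantissa st k) + 1) * 8 ^ (J k - p)"
    if k: "k \<in> {1..n}" for k
  proof -
    have k': "k - 1 < n" using k by auto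
    obtain j r m1 r' where *: "es ! (k - 1) = j # r # m1" "st ! (k - 1) = r' # m1"
      using st(2)[OF k'] by blast
    define xs where "xs = vs ! (k - 1)"
    have octx: "octal xs" using k' by (auto simp: xs_def n_def intro: oct)
    have "es ! (k - 1) = count_digits p [] (rev xs) (length xs)"
      using k' count_digits[of p xs "[]" 0] by (simp add: es_def n_def xs_def)
    with * have c: "j = length xs" "r = 1" "m1 = take_rev p (rev xs) []" "xs \<noteq> []" "last xs \<noteq> 0"
        "p \<le> length xs"
      by (auto simp: hd_rev split: if_splits)
    have m1: "m1 = rev (take p (rev xs))" using c by (simp add: take_rev)
    then have m1': "m1 = drop (length xs - p) xs" by (simp add: rev_take)
    define low where "low = take (length xs - p) xs"
    have xs_eq: "xs = low @ m1" by (simp add: low_def m1')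
    have len: "length low = length xs - p" "length m1 = p" using c(6) by (simp add: low_def, simp add: m1)
    have "octal low" "octal m1" using octx xs_eq by auto
    then have low: "oval low < 8 ^ (length xs - p)" using oval_less[of low] len by simp
    have val: "oval xs = oval low + 8 ^ (length xs - p) * oval m1"
      using len by (simp add: xs_eq oval_append)
    have "m1 \<noteq> []" using len \<open>0 < p\<close> by auto
    then have "last m1 \<noteq> 0" using c(5) by (simp add: xs_eq)
    have "m1 = butlast m1 @ [last m1]" using \<open>m1 \<noteq> []\<close> by simp
    then have "oval m1 = oval (butlast m1) + 8 ^ (p - 1) * last m1"
      using oval_append[of "butlast m1" "[last m1]"] len by simp
    moreover have "(8::nat) ^ (p - 1) \<le> 8 ^ (p - 1) * last m1" using \<open>last m1 \<noteq> 0\<close> by simp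
    ultimately have "8 ^ (p - 1) \<le> oval m1" by linarith
    then have big: "8 ^ p \<le> 8 * oval m1" using \<open>0 < p\<close> by (cases p) auto
    have "mantissa st k = m1" using * k st(1) by (auto simp: mantissa_def)
    moreover have "J k = length xs" using * c by (simp add: J_def)
    ultimately show ?thesis
      using * c len big val low \<open>octal m1\<close> unfolding xs_def by (auto simp: algebra_simps)
  qed
  define w where "w k = (if k \<in> {1..n} then 8 ^ J k / 8 ^ p else (1 :: real))" for k
  have "approximates (2 * d + 8 / 8 ^ p) p x st"
    unfolding approximates_def st(1)
  proof (intro conjI ballI exI[of _ w] allI impI)
    fix k assume "k = 0 \<or> n < k"
    then show "x k = 0" using x0 by (simp add: n_def)
  next
    fix k assume k: "k \<in> {1..n}"
    from entry[OF k] show "octal (mantissa st k)" "length (mantissa st k) = p"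
      "8 ^ p \<le> 8 * oval (mantissa st k)" by blast+
  next
    fix k show "0 < w k" by (simp add: w_def)
  next
    fix k assume k: "1 < k \<and> k < n"
    then have k': "k - 1 < n" "0 < k - 1" "Suc (k - 1) = k" "k \<in> {1..n}" "k - 1 \<in> {1..n}" "k + 1 \<in> {1..n}"
      by auto
    obtain j r m1 r' where *: "es ! (k - 1) = j # r # m1" "st ! (k - 1) = r' # m1"
      "r' + Suc (hd (es ! (k - 1 - 1)) + hd (es ! k)) = r + (r + (j + j))"
      using st(2)[OF k'(1)] k k' by auto
    have "r = 1" using entry[OF k'(4)] * by simp
    then have "exponent st k + (J (k - 1) + J (k + 1)) = Suc (J k + J k)"
      using * by (simp add: J_def exponent_def)
    then have "8 ^ (exponent st k + (J (k - 1) + J (k + 1))) = (8 :: real) ^ Suc (J k + J k)" by simp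
    then show "8 * (w k)\<^sup>2 = 8 ^ exponent st k * (w (k - 1) * w (k + 1))"
      using k' by (simp add: w_def power_add power2_eq_square)
  next
    fix k assume k: "k \<in> {1..n}"
    define a v where "a = oval (mantissa st k)" and "v = oval (vs ! (k - 1))"
    define u where "u = (8 :: real) ^ (J k - p)"
    have w_eq: "w k = u" using entry[OF k] k by (simp add: w_def u_def power_diff)
    have "a * 8 ^ (J k - p) \<le> v" "v < (a + 1) * 8 ^ (J k - p)" "8 ^ p \<le> 8 * a"
      using entry[OF k] by (auto simp: a_def v_def)
    then have "real (a * 8 ^ (J k - p)) \<le> real v" "real v < real ((a + 1) * 8 ^ (J k - p))"
      "real (8 ^ p) \<le> real (8 * a)" by (simp_all only: of_nat_le_iff of_nat_less_iff)
    then have v: "a * u \<le> v" "v < a * u + u" and a: "8 ^ p \<le> 8 * real a"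
      by (simp_all add: u_def algebra_simps)
    have "0 < u" by (simp add: u_def)
    have "(0 :: real) < 8 ^ p" by simp
    then have "0 < real a" using a by linarith
    then have a': "1 \<le> real a * (8 / 8 ^ p)" "1 \<le> real a" using a by (simp_all add: field_simps)
    then have "u * 1 \<le> u * (real a * (8 / 8 ^ p))" using \<open>0 < u\<close> by (intro mult_left_mono) auto
    moreover have ua: "u * 1 \<le> u * a" using a' \<open>0 < u\<close> by (intro mult_left_mono) auto
    moreover have "v \<le> a * u + a * u"
      using v ua unfolding mult.commute[of u] mult_1_left by linarith
    then have "d * v \<le> d * (a * u + a * u)" using \<open>0 \<le> d\<close> by (rule mult_left_mono)
    moreover have "v \<le> x k" "x k \<le> v + d * v" using x[of k] k by (simp_all add: v_def n_def algebra_simps)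
    ultimately have "\<bar>x k - u * a\<bar> \<le> d * (a * u + a * u) + u * (a * (8 / 8 ^ p))"
      using v by (simp add: algebra_simps)
    then show "\<bar>x k - w k * oval (mantissa st k)\<bar> \<le> (2 * d + 8 / 8 ^ p) * (w k * oval (mantissa st k))"
      unfolding w_eq a_def[symmetric] by (simp add: algebra_simps)
  qed
  then show "approximates (2 * d + 8 / 8 ^ p) p x (float_row p vs)"
    by (simp add: float_row_def es_def st_def)
qed

section \<open>The sequences as rows of a Pascal triangle\<close>

fun octal_digits :: "nat \<Rightarrow> nat list" where
  "octal_digits n = (if n = 0 then [] else n mod 8 # octal_digits (n div 8))"

declare octal_digits.simps [simp del]

lemma octal_digits: "oval (octal_digits n) = n \<and> octal (octal_digits n)"
proof (induction n rule: octal_digits.induct)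
  case (1 n)
  then show ?case by (subst (1 2) octal_digits.simps) simp
qed

definition recip :: "nat \<Rightarrow> nat list" where
  "recip n = octal_digits (8 ^ 20 div n)"

fun pascal :: "nat list \<Rightarrow> nat list list \<Rightarrow> nat list \<Rightarrow> nat list list" where
  "pascal xs [] t = [add_carry xs t False]"
| "pascal xs (ys # vs) t = add_carry ys xs False # pascal ys vs t"

fun harm_row :: "nat \<Rightarrow> nat list list" where
  "harm_row 0 = []"
| "harm_row (Suc n) = pascal [] (harm_row n) (recip (Suc n))"

definition harm_coeff :: "nat \<Rightarrow> nat \<Rightarrow> real" where
  "harm_coeff n k = real (n choose k) * (harm n - harm (n - k))"

text \<open>The step to \<open>n + 1\<close> adds \<open>1 / (n + 1)\<close> to the first harmonic
  number. By absorption, \<open>(n + 1 choose k) / (n + 1) = (n choose k) / (n + 1 - k)\<close>,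
  which is what turns \<open>harm (n + 1 - k)\<close> into \<open>harm (n - k)\<close> in the
  summand \<open>harm_coeff n k\<close>. At \<open>k = n + 1\<close> that summand is zero by
  definition and the added \<open>1 / (n + 1)\<close> replaces it.\<close>

lemma harm_coeff_Suc:
  assumes "1 \<le> k" "k \<le> Suc n"
  shows "harm_coeff (Suc n) k =
    (if k \<le> n then harm_coeff n k else 1 / real (Suc n)) + harm_coeff n (k - 1)"
proof (cases "k \<le> n")
  case True
  define m where "m = n - k"
  then have n: "n = m + k" "Suc n - k = Suc m" "n - (k - 1) = Suc m" using True assms by auto
  have "real (Suc m) * real (Suc n choose k) = real (Suc n) * real (n choose k)"
  proof -
    have "(Suc n - k) * (Suc n choose k) = Suc n * (n choose k)"
      using binomial_absorb_comp[of "Suc n" k] by simp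
    then show ?thesis using n by (metis of_nat_mult)
  qed
  then have absorb: "real (Suc n choose k) / real (Suc n) = real (n choose k) / real (Suc m)"
    by (simp add: field_simps)
  have pascal: "real (Suc n choose k) = real (n choose k) + real (n choose (k - 1))"
    using assms by (cases k) auto
  have "harm_coeff (Suc n) k = real (Suc n choose k) * (harm n - harm (Suc m)) + real (Suc n choose k) / real (Suc n)"
    by (simp add: harm_coeff_def n(2) harm_Suc[of n] field_simps)
  also have "\<dots> = real (n choose k) * (harm n - harm (Suc m) + 1 / real (Suc m))
      + real (n choose (k - 1)) * (harm n - harm (Suc m))"
    unfolding absorb unfolding pascal by (simp add: algebra_simps)
  also have "harm n - harm (Suc m) + 1 / real (Suc m) = harm n - (harm m :: real)"
    by (simp add: harm_Suc[of m] inverse_eq_divide)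
  finally show ?thesis using True n by (simp add: harm_coeff_def)
next
  case False
  then have "k = Suc n" using assms by simp
  then show ?thesis by (simp add: harm_coeff_def harm_Suc[of n] inverse_eq_divide harm_expand(1))
qed

lemma pascal:
  "length (pascal xs vs t) = Suc (length vs)"
  "octal xs \<Longrightarrow> (\<And>ys. ys \<in> set vs \<Longrightarrow> octal ys) \<Longrightarrow> octal t \<Longrightarrow> i \<le> length vs \<Longrightarrow>
    octal (pascal xs vs t ! i) \<and> oval (pascal xs vs t ! i) =
      (if i < length vs then oval (vs ! i) else oval t) + oval (if i = 0 then xs else vs ! (i - 1))"
proof (induction xs vs t arbitrary: i rule: pascal.induct)
  case (2 xs ys vs t)
  {
    case 2
    show ?case
    proof (cases i)
      case 0
      then show ?thesis using add_carry[of ys xs False] "2.prems" by auto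
    next
      case (Suc j)
      then show ?thesis using "2.IH"(2)[of j] "2.prems" by (cases j) auto
    qed
  }
qed (use add_carry[of _ _ False] in auto)

text \<open>For \<open>n \<le> 512 = 8 ^ 3\<close> the quotient is at least \<open>8 ^ 17\<close>,
  so the fraction dropped is at most one part in \<open>8 ^ 17\<close> of it.\<close>

lemma recip:
  assumes "1 \<le> n" "n \<le> 512"
  shows "octal (recip n)" "real (oval (recip n)) \<le> 8 ^ 20 / real n"
    "8 ^ 20 / real n \<le> (1 + 1 / 8 ^ 17) * real (oval (recip n))"
proof -
  define t where "t = (8::nat) ^ 20 div n"
  have t: "oval (recip n) = t" "octal (recip n)"
    using octal_digits by (auto simp: recip_def t_def)
  have "8 ^ 17 * n \<le> (8::nat) ^ 20" using assms by simp
  then have "8 ^ 17 \<le> t" using assms by (simp only: t_def less_eq_div_iff_mult_less_eq)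
  then have "real (8 ^ 17) \<le> real t" by (simp only: of_nat_le_iff)
  then have big: "1 \<le> real t / 8 ^ 17" by simp
  have "t * n \<le> 8 ^ 20" "8 ^ 20 < n + t * n"
    unfolding t_def using div_times_less_eq_dividend dividend_less_div_times assms by simp_all
  then have "real (t * n) \<le> real (8 ^ 20)" "real (8 ^ 20) < real (n + t * n)"
    by (simp_all only: of_nat_le_iff of_nat_less_iff)
  then have *: "real t * n \<le> 8 ^ 20" "8 ^ 20 \<le> (real t + 1) * n"
    by (simp_all add: distrib_right)
  show "octal (recip n)" by (rule t)
  show "real (oval (recip n)) \<le> 8 ^ 20 / real n" using *(1) assms t by (simp add: field_simps)
  have "8 ^ 20 / real n \<le> real t + 1" using *(2) assms by (simp add: field_simps)
  also have "\<dots> \<le> real t + real t / 8 ^ 17" using big by simp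
  finally show "8 ^ 20 / real n \<le> (1 + 1 / 8 ^ 17) * real (oval (recip n))"
    by (simp add: t algebra_simps)
qed

text \<open>Pascal's rule only adds numbers that are nonnegative. Two-sided bounds with a common
  factor are inherited by such sums, so the relative error of the reciprocals does not grow from row
  to row.\<close>

lemma harm_row:
  assumes "n \<le> 512"
  shows "length (harm_row n) = n \<and> (\<forall>k\<in>{1..n}. octal (harm_row n ! (k - 1)) \<and>
    real (oval (harm_row n ! (k - 1))) \<le> 8 ^ 20 * harm_coeff n k \<and>
    8 ^ 20 * harm_coeff n k \<le> (1 + 1 / 8 ^ 17) * real (oval (harm_row n ! (k - 1))))"
  using assms
proof (induction n)
  case (Suc n)
  define vs t where "vs = harm_row n" and "t = recip (Suc n)"
  define c :: real where "c = 1 + 1 / 8 ^ 17"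
  have c: "0 \<le> c" by (simp add: c_def)
  have IH: "length vs = n" "\<And>k. k \<in> {1..n} \<Longrightarrow> octal (vs ! (k - 1)) \<and>
      real (oval (vs ! (k - 1))) \<le> 8 ^ 20 * harm_coeff n k \<and>
      8 ^ 20 * harm_coeff n k \<le> c * real (oval (vs ! (k - 1)))"
    using Suc by (auto simp: vs_def c_def)
  have t: "octal t" "real (oval t) \<le> 8 ^ 20 * (1 / real (Suc n))" "8 ^ 20 * (1 / real (Suc n)) \<le> c * oval t"
    using recip[of "Suc n"] Suc.prems by (simp_all add: t_def c_def)
  have oct: "octal ys" if "ys \<in> set vs" for ys
  proof -
    obtain i where "i < n" "ys = vs ! i" using \<open>ys \<in> set vs\<close> IH(1) by (auto simp: in_set_conv_nth)
    then show ?thesis using IH(2)[of "Suc i"] by simp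
  qed
  show ?case
  proof (intro conjI ballI)
    show "length (harm_row (Suc n)) = Suc n" using IH(1) by (simp add: pascal vs_def)
    fix k assume k: "k \<in> {1..Suc n}"
    define a where "a = (if k \<le> n then oval (vs ! (k - 1)) else oval t)"
    define b where "b = oval (if k - 1 = 0 then [] else vs ! (k - 1 - 1))"
    have row: "octal (harm_row (Suc n) ! (k - 1))" "oval (harm_row (Suc n) ! (k - 1)) = a + b"
    proof -
      obtain j where j: "k = Suc j" using k by (cases k) auto
      show "octal (harm_row (Suc n) ! (k - 1))" "oval (harm_row (Suc n) ! (k - 1)) = a + b"
        using pascal(2)[of "[]" vs t j] oct t(1) k IH(1)
        by (auto simp: a_def b_def vs_def[symmetric] t_def[symmetric] j)
    qed
    define \<alpha> \<beta> where "\<alpha> = (if k \<le> n then harm_coeff n k else 1 / real (Suc n))"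
      and "\<beta> = harm_coeff n (k - 1)"
    have h: "harm_coeff (Suc n) k = \<alpha> + \<beta>"
      using k unfolding \<alpha>_def \<beta>_def by (intro harm_coeff_Suc) auto
    have a: "real a \<le> 8 ^ 20 * \<alpha> \<and> 8 ^ 20 * \<alpha> \<le> c * real a"
    proof (cases "k \<le> n")
      case True
      then show ?thesis using IH(2)[of k] k by (simp add: a_def \<alpha>_def)
    next
      case False
      then show ?thesis using t(2,3) by (simp only: a_def \<alpha>_def if_False)
    qed
    have b: "real b \<le> 8 ^ 20 * \<beta> \<and> 8 ^ 20 * \<beta> \<le> c * real b"
    proof (cases "k - 1 = 0")
      case True
      then show ?thesis by (simp add: b_def \<beta>_def harm_coeff_def)
    next
      case False
      then have "k - 1 \<in> {1..n}" using k by auto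
      then show ?thesis using IH(2)[of "k - 1"] False by (simp only: b_def \<beta>_def if_False)
    qed
    show "octal (harm_row (Suc n) ! (k - 1))" by (rule row)
    show "real (oval (harm_row (Suc n) ! (k - 1))) \<le> 8 ^ 20 * harm_coeff (Suc n) k"
      unfolding row(2) h distrib_left of_nat_add by (intro add_mono) (use a b in auto)
    show "8 ^ 20 * harm_coeff (Suc n) k \<le> (1 + 1 / 8 ^ 17) * real (oval (harm_row (Suc n) ! (k - 1)))"
      unfolding row(2) h distrib_left of_nat_add c_def[symmetric]
      by (intro add_mono) (use a b in auto)
  qed
qed simp

text \<open>The operator is homogeneous of degree two. Hence \<open>n!\<close> and the scale
  \<open>8 ^ 20\<close> of the integer rows do not affect positivity.\<close>

lemma L_nat_power_scale:
  assumes "0 < c"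
  shows "\<exists>d>0. \<forall>k. (L_nat ^^ s) (\<lambda>k. c * x k) k = d * (L_nat ^^ s) x k"
proof (induction s)
  case (Suc s)
  then obtain d where d: "0 < d" "\<And>k. (L_nat ^^ s) (\<lambda>k. c * x k) k = d * (L_nat ^^ s) x k" by auto
  have "(L_nat ^^ Suc s) (\<lambda>k. c * x k) k = d\<^sup>2 * (L_nat ^^ Suc s) x k" for k
    using d(2) by (simp add: L_nat_def[of "(L_nat ^^ s) _"] power2_eq_square algebra_simps)
  then show ?case using d(1) by (intro exI[of _ "d\<^sup>2"]) simp
qed (use assms in auto)

definition initial_error :: "nat \<Rightarrow> real" where
  "initial_error p = 2 / 8 ^ 17 + 8 / 8 ^ p"

lemma infinite_logconcave_A_seq:
  assumes "n \<le> 512" "0 < p" "run t p sched (float_row p (harm_row n))"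
    "error_ok t (initial_error p) p sched"
  shows "infinite_logconcave 1 (int n) (A_seq n)"
proof (rule infinite_logconcaveI)
  fix s k assume k: "1 \<le> k" "k \<le> n"
  define x where "x k = 8 ^ 20 * harm_coeff n k" for k
  have row: "length (harm_row n) = n" "\<And>k. k \<in> {1..n} \<Longrightarrow> octal (harm_row n ! (k - 1)) \<and>
      real (oval (harm_row n ! (k - 1))) \<le> x k \<and>
      x k \<le> (1 + 1 / 8 ^ 17) * real (oval (harm_row n ! (k - 1)))"
    using harm_row[OF assms(1)] by (auto simp: x_def)
  have oct: "octal xs" if "xs \<in> set (harm_row n)" for xs
  proof -
    obtain i where "i < n" "xs = harm_row n ! i"
      using \<open>xs \<in> set (harm_row n)\<close> row(1) by (auto simp: in_set_conv_nth)
    then show ?thesis using row(2)[of "Suc i"] by simp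
  qed
  have ok: "[] \<notin> set (float_row p (harm_row n))" using assms(3) run_failure by blast
  have x0: "x k = 0" if "k = 0 \<or> length (harm_row n) < k" for k
    using that row(1) by (auto simp: x_def harm_coeff_def)
  have "approximates (2 * (1 / 8 ^ 17) + 8 / 8 ^ p) p x (float_row p (harm_row n))"
    using ok x0 oct assms(2) row by (intro float_row) auto
  then have approx: "approximates (initial_error p) p x (float_row p (harm_row n))"
    by (simp add: initial_error_def)
  have "length (float_row p (harm_row n)) = n"
    using float_row(2)[OF ok x0 oct assms(2), where d = "1 / 8 ^ 17"] row by auto
  then have pos: "0 < (L_nat ^^ s) x k"
    using run_positive[OF approx _ assms(4,3)] k by (simp add: initial_error_def)
  have "(\<lambda>k. zero_ext 1 (int n) (A_seq n) (int k)) = (\<lambda>k. 1 / (fact n * 8 ^ 20) * x k)"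
    by (auto simp: fun_eq_iff zero_ext_def A_seq_def A_coeff_def x_def harm_coeff_def not_le)
  then show "0 < (L_nat ^^ s) (\<lambda>k. zero_ext 1 (int n) (A_seq n) (int k)) k"
    using L_nat_power_scale[where c = "1 / (fact n * 8 ^ 20)" and s = s and x = x] pos by auto
qed

section \<open>Blocks of ten consecutive rows\<close>

fun extend_rows :: "nat list list \<Rightarrow> nat list list \<Rightarrow> nat list list" where
  "extend_rows [] vs = vs"
| "extend_rows (t # ts) vs = extend_rows ts (pascal [] vs t)"

fun check_rows :: "nat list \<Rightarrow> nat \<Rightarrow> (nat \<times> nat list) list \<Rightarrow> nat list list \<Rightarrow> nat list list \<Rightarrow> bool" where
  "check_rows t p sched [] vs \<longleftrightarrow> True"
| "check_rows t p sched (v # ts) vs \<longleftrightarrow> run t p sched (float_row p (pascal [] vs v)) \<and>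
    check_rows t p sched ts (pascal [] vs v)"

definition block :: "nat \<Rightarrow> nat list list" where
  "block n = map (\<lambda>i. recip (Suc (n + i))) [0..<10]"

text \<open>The listed quotients of \<open>8 ^ 20\<close> are certified by multiplication, so no
  long division has to be evaluated.\<close>

lemma block_eqI:
  assumes "length qs = 10" "\<forall>(i, q)\<in>set (List.enumerate (Suc n) qs). q * i \<le> 8 ^ 20 \<and> 8 ^ 20 < q * i + i"
  shows "block n = map octal_digits qs"
proof (rule nth_equalityI)
  show "length (block n) = length (map octal_digits qs)" using assms(1) by (simp only: block_def) simp
  fix i assume "i < length (block n)"
  then have i: "i < 10" by (simp only: block_def) simp
  have "(Suc n + i, qs ! i) \<in> set (List.enumerate (Suc n) qs)"
    using nth_mem[of i "List.enumerate (Suc n) qs"] i assms(1) by (simp only: length_enumerate nth_enumerate_eq)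
  then have q: "qs ! i * (Suc n + i) \<le> 8 ^ 20" "8 ^ 20 < qs ! i * (Suc n + i) + (Suc n + i)"
    using assms(2) by blast+
  have "N div j = q" if "q * j \<le> N" "N < q * j + j" for N j q :: nat
    using that by (intro div_nat_eqI) (simp_all add: mult.commute add.commute)
  from this[OF q] have "8 ^ 20 div Suc (n + i) = qs ! i" by (simp only: add_Suc)
  then show "block n ! i = map octal_digits qs ! i"
    using i assms(1) by (simp only: block_def recip_def nth_map length_upt nth_upt add_0 diff_zero)
qed

lemma harm_row_extend:
  "extend_rows (map (\<lambda>i. recip (Suc (n + i))) [0..<k]) (harm_row n) = harm_row (n + k)"
proof -
  have snoc: "extend_rows (ts @ [t]) vs = pascal [] (extend_rows ts vs) t" for ts t vs
    by (induction ts arbitrary: vs) auto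
  show ?thesis by (induction k) (simp_all add: snoc)
qed

text \<open>Every tenth row is evaluated and stored as a theorem by means of this equation, so that
  a block starts from the stored row instead of the top of the triangle.\<close>

lemma harm_row_block: "harm_row (n + 10) = extend_rows (block n) (harm_row n)"
  by (simp only: block_def harm_row_extend)

lemma check_rows_iff:
  "check_rows t p sched ts vs \<longleftrightarrow>
    (\<forall>i<length ts. run t p sched (float_row p (extend_rows (take (Suc i) ts) vs)))"
proof (induction ts arbitrary: vs)
  case (Cons v ts)
  have "(\<forall>i<length (v # ts). run t p sched (float_row p (extend_rows (take (Suc i) (v # ts)) vs))) \<longleftrightarrow>
      run t p sched (float_row p (pascal [] vs v)) \<and>
      (\<forall>i<length ts. run t p sched (float_row p (extend_rows (take (Suc i) ts) (pascal [] vs v))))"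
    by (simp only: length_Cons All_less_Suc2 take_Suc_Cons take_0 extend_rows.simps)
  then show ?case by (simp only: check_rows.simps Cons)
qed simp

lemma check_rows:
  assumes "check_rows t p sched (map (\<lambda>i. recip (Suc (n + i))) [0..<k]) (harm_row n)" "i < k"
  shows "run t p sched (float_row p (harm_row (Suc (n + i))))"
proof -
  let ?ts = "\<lambda>k. map (\<lambda>i. recip (Suc (n + i))) [0..<k]"
  have "\<forall>i<length (?ts k). run t p sched (float_row p (extend_rows (take (Suc i) (?ts k)) (harm_row n)))"
    using assms(1) by (simp only: check_rows_iff)
  moreover have "i < length (?ts k)" using assms(2) by simp
  ultimately have "run t p sched (float_row p (extend_rows (take (Suc i) (?ts k)) (harm_row n)))" by blast
  moreover have "take (Suc i) (?ts k) = ?ts (Suc i)"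
    using assms(2) by (simp only: take_map take_upt add_0 Suc_leI)
  ultimately show ?thesis by (simp only: harm_row_extend add_Suc_right)
qed

definition verified_block :: "nat \<Rightarrow> bool" where
  "verified_block n \<longleftrightarrow> (\<forall>i\<in>{n<..n + 10}. infinite_logconcave 1 (int i) (A_seq i))"

text \<open>One schedule serves all ten rows. The bound 500 keeps them within the 512 rows for which
  the reciprocals are accurate enough.\<close>

lemma verified_blockI:
  assumes "n \<le> 500" "check_rows t p sched (block n) (harm_row n)"
    "error_ok t (initial_error p) p sched" "0 < p"
  shows "verified_block n"
  unfolding verified_block_def
proof
  fix i assume i: "i \<in> {n<..n + 10}"
  then have "i = Suc (n + (i - Suc n))" "i - Suc n < 10" by auto
  then have "run t p sched (float_row p (harm_row i))"
    using check_rows[of t p sched n 10 "i - Suc n"] assms(2) by (simp add: block_def)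
  then show "infinite_logconcave 1 (int i) (A_seq i)"
    using infinite_logconcave_A_seq[of i p t sched] assms i by simp
qed

section \<open>Evaluation by rewriting\<close>

text \<open>Digit lists are built from the constants \<open>o0\<close>, ..., \<open>o7\<close> (\<open>Cons\<close> with a fixed digit, least
  significant digit first): rewriting is several times faster on such small monomorphic terms.\<close>

definition "o0 = (#) (0 :: nat)"
definition "o1 = (#) (1 :: nat)"
definition "o2 = (#) (2 :: nat)"
definition "o3 = (#) (3 :: nat)"
definition "o4 = (#) (4 :: nat)"
definition "o5 = (#) (5 :: nat)"
definition "o6 = (#) (6 :: nat)"
definition "o7 = (#) (7 :: nat)"

text \<open>The first index is the multiplier, the second the carry. With both in the head constant,
  a rewrite step has to match only the digits of the two operands.\<close>

definition "muladd00 = muladd_digit 0 0"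
definition "muladd01 = muladd_digit 0 1"
definition "muladd02 = muladd_digit 0 2"
definition "muladd03 = muladd_digit 0 3"
definition "muladd04 = muladd_digit 0 4"
definition "muladd05 = muladd_digit 0 5"
definition "muladd06 = muladd_digit 0 6"
definition "muladd07 = muladd_digit 0 7"
definition "muladd10 = muladd_digit 1 0"
definition "muladd11 = muladd_digit 1 1"
definition "muladd12 = muladd_digit 1 2"
definition "muladd13 = muladd_digit 1 3"
definition "muladd14 = muladd_digit 1 4"
definition "muladd15 = muladd_digit 1 5"
definition "muladd16 = muladd_digit 1 6"
definition "muladd17 = muladd_digit 1 7"
definition "muladd20 = muladd_digit 2 0"
definition "muladd21 = muladd_digit 2 1"
definition "muladd22 = muladd_digit 2 2"
definition "muladd23 = muladd_digit 2 3"
definition "muladd24 = muladd_digit 2 4"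
definition "muladd25 = muladd_digit 2 5"
definition "muladd26 = muladd_digit 2 6"
definition "muladd27 = muladd_digit 2 7"
definition "muladd30 = muladd_digit 3 0"
definition "muladd31 = muladd_digit 3 1"
definition "muladd32 = muladd_digit 3 2"
definition "muladd33 = muladd_digit 3 3"
definition "muladd34 = muladd_digit 3 4"
definition "muladd35 = muladd_digit 3 5"
definition "muladd36 = muladd_digit 3 6"
definition "muladd37 = muladd_digit 3 7"
definition "muladd40 = muladd_digit 4 0"
definition "muladd41 = muladd_digit 4 1"
definition "muladd42 = muladd_digit 4 2"
definition "muladd43 = muladd_digit 4 3"
definition "muladd44 = muladd_digit 4 4"
definition "muladd45 = muladd_digit 4 5"
definition "muladd46 = muladd_digit 4 6"
definition "muladd47 = muladd_digit 4 7"
definition "muladd50 = muladd_digit 5 0"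
definition "muladd51 = muladd_digit 5 1"
definition "muladd52 = muladd_digit 5 2"
definition "muladd53 = muladd_digit 5 3"
definition "muladd54 = muladd_digit 5 4"
definition "muladd55 = muladd_digit 5 5"
definition "muladd56 = muladd_digit 5 6"
definition "muladd57 = muladd_digit 5 7"
definition "muladd60 = muladd_digit 6 0"
definition "muladd61 = muladd_digit 6 1"
definition "muladd62 = muladd_digit 6 2"
definition "muladd63 = muladd_digit 6 3"
definition "muladd64 = muladd_digit 6 4"
definition "muladd65 = muladd_digit 6 5"
definition "muladd66 = muladd_digit 6 6"
definition "muladd67 = muladd_digit 6 7"
definition "muladd70 = muladd_digit 7 0"
definition "muladd71 = muladd_digit 7 1"
definition "muladd72 = muladd_digit 7 2"
definition "muladd73 = muladd_digit 7 3"
definition "muladd74 = muladd_digit 7 4"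
definition "muladd75 = muladd_digit 7 5"
definition "muladd76 = muladd_digit 7 6"
definition "muladd77 = muladd_digit 7 7"

text \<open>Boolean flags are absorbed into the constants as well; \<open>drop_digits\<close> fixes
  the element type of \<open>drop\<close>.\<close>

definition "add0 xs ys = add_carry xs ys False"
definition "add1 xs ys = add_carry xs ys True"
definition "subtract0 xs ys acc = subtract_rev xs ys False acc"
definition "subtract1 xs ys acc = subtract_rev xs ys True acc"
definition "below0 xs ys = below xs ys False"
definition "below1 xs ys = below xs ys True"
definition "drop_digits r xs = drop r (xs :: nat list)"

lemmas flag_defs =
  add0_def add1_def subtract0_def subtract1_def below0_def below1_def drop_digits_def

lemmas cons_defs = o0_def o1_def o2_def o3_def o4_def o5_def o6_def o7_def
lemmas muladd_defs =
  muladd00_def muladd01_def muladd02_def muladd03_def muladd04_def muladd05_def muladd06_def muladd07_def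
  muladd10_def muladd11_def muladd12_def muladd13_def muladd14_def muladd15_def muladd16_def muladd17_def
  muladd20_def muladd21_def muladd22_def muladd23_def muladd24_def muladd25_def muladd26_def muladd27_def
  muladd30_def muladd31_def muladd32_def muladd33_def muladd34_def muladd35_def muladd36_def muladd37_def
  muladd40_def muladd41_def muladd42_def muladd43_def muladd44_def muladd45_def muladd46_def muladd47_def
  muladd50_def muladd51_def muladd52_def muladd53_def muladd54_def muladd55_def muladd56_def muladd57_def
  muladd60_def muladd61_def muladd62_def muladd63_def muladd64_def muladd65_def muladd66_def muladd67_def
  muladd70_def muladd71_def muladd72_def muladd73_def muladd74_def muladd75_def muladd76_def muladd77_def

section \<open>Rewrite tables for the digit functions\<close>

definition all_digits :: "(nat \<Rightarrow> bool) \<Rightarrow> bool" where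
  "all_digits Q \<longleftrightarrow> Q 0 \<and> Q 1 \<and> Q 2 \<and> Q 3 \<and> Q 4 \<and> Q 5 \<and> Q 6 \<and> Q 7"

text \<open>A single schematic proof yields eight closed instances, whose arithmetic is evaluated
  once and whose digits are folded into constants; nesting gives one rule per tuple of
  digits.\<close>

lemma all_digitsI: "(\<And>x. Q x) \<Longrightarrow> all_digits Q"
  by (simp add: all_digits_def)

declare muladd_digit.simps [simp del] muladd.simps [simp del] add_carry.simps [simp del]
  subtract_rev.simps [simp del] below.simps [simp del] take_rev.simps [simp del] strip.simps [simp del]
  count_digits.simps [simp del]

text \<open>The table ends at 63, the largest value of \<open>d * x + y + c\<close> for
  digits.\<close>

lemma div_mod_8:
  "0 mod 8 = (0 :: nat)" "0 div 8 = (0 :: nat)" "1 mod 8 = (1 :: nat)" "1 div 8 = (0 :: nat)"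
  "2 mod 8 = (2 :: nat)" "2 div 8 = (0 :: nat)" "3 mod 8 = (3 :: nat)" "3 div 8 = (0 :: nat)"
  "4 mod 8 = (4 :: nat)" "4 div 8 = (0 :: nat)" "5 mod 8 = (5 :: nat)" "5 div 8 = (0 :: nat)"
  "6 mod 8 = (6 :: nat)" "6 div 8 = (0 :: nat)" "7 mod 8 = (7 :: nat)" "7 div 8 = (0 :: nat)"
  "8 mod 8 = (0 :: nat)" "8 div 8 = (1 :: nat)" "9 mod 8 = (1 :: nat)" "9 div 8 = (1 :: nat)"
  "10 mod 8 = (2 :: nat)" "10 div 8 = (1 :: nat)" "11 mod 8 = (3 :: nat)" "11 div 8 = (1 :: nat)"
  "12 mod 8 = (4 :: nat)" "12 div 8 = (1 :: nat)" "13 mod 8 = (5 :: nat)" "13 div 8 = (1 :: nat)"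
  "14 mod 8 = (6 :: nat)" "14 div 8 = (1 :: nat)" "15 mod 8 = (7 :: nat)" "15 div 8 = (1 :: nat)"
  "16 mod 8 = (0 :: nat)" "16 div 8 = (2 :: nat)" "17 mod 8 = (1 :: nat)" "17 div 8 = (2 :: nat)"
  "18 mod 8 = (2 :: nat)" "18 div 8 = (2 :: nat)" "19 mod 8 = (3 :: nat)" "19 div 8 = (2 :: nat)"
  "20 mod 8 = (4 :: nat)" "20 div 8 = (2 :: nat)" "21 mod 8 = (5 :: nat)" "21 div 8 = (2 :: nat)"
  "22 mod 8 = (6 :: nat)" "22 div 8 = (2 :: nat)" "23 mod 8 = (7 :: nat)" "23 div 8 = (2 :: nat)"
  "24 mod 8 = (0 :: nat)" "24 div 8 = (3 :: nat)" "25 mod 8 = (1 :: nat)" "25 div 8 = (3 :: nat)"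
  "26 mod 8 = (2 :: nat)" "26 div 8 = (3 :: nat)" "27 mod 8 = (3 :: nat)" "27 div 8 = (3 :: nat)"
  "28 mod 8 = (4 :: nat)" "28 div 8 = (3 :: nat)" "29 mod 8 = (5 :: nat)" "29 div 8 = (3 :: nat)"
  "30 mod 8 = (6 :: nat)" "30 div 8 = (3 :: nat)" "31 mod 8 = (7 :: nat)" "31 div 8 = (3 :: nat)"
  "32 mod 8 = (0 :: nat)" "32 div 8 = (4 :: nat)" "33 mod 8 = (1 :: nat)" "33 div 8 = (4 :: nat)"
  "34 mod 8 = (2 :: nat)" "34 div 8 = (4 :: nat)" "35 mod 8 = (3 :: nat)" "35 div 8 = (4 :: nat)"
  "36 mod 8 = (4 :: nat)" "36 div 8 = (4 :: nat)" "37 mod 8 = (5 :: nat)" "37 div 8 = (4 :: nat)"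
  "38 mod 8 = (6 :: nat)" "38 div 8 = (4 :: nat)" "39 mod 8 = (7 :: nat)" "39 div 8 = (4 :: nat)"
  "40 mod 8 = (0 :: nat)" "40 div 8 = (5 :: nat)" "41 mod 8 = (1 :: nat)" "41 div 8 = (5 :: nat)"
  "42 mod 8 = (2 :: nat)" "42 div 8 = (5 :: nat)" "43 mod 8 = (3 :: nat)" "43 div 8 = (5 :: nat)"
  "44 mod 8 = (4 :: nat)" "44 div 8 = (5 :: nat)" "45 mod 8 = (5 :: nat)" "45 div 8 = (5 :: nat)"
  "46 mod 8 = (6 :: nat)" "46 div 8 = (5 :: nat)" "47 mod 8 = (7 :: nat)" "47 div 8 = (5 :: nat)"
  "48 mod 8 = (0 :: nat)" "48 div 8 = (6 :: nat)" "49 mod 8 = (1 :: nat)" "49 div 8 = (6 :: nat)"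
  "50 mod 8 = (2 :: nat)" "50 div 8 = (6 :: nat)" "51 mod 8 = (3 :: nat)" "51 div 8 = (6 :: nat)"
  "52 mod 8 = (4 :: nat)" "52 div 8 = (6 :: nat)" "53 mod 8 = (5 :: nat)" "53 div 8 = (6 :: nat)"
  "54 mod 8 = (6 :: nat)" "54 div 8 = (6 :: nat)" "55 mod 8 = (7 :: nat)" "55 div 8 = (6 :: nat)"
  "56 mod 8 = (0 :: nat)" "56 div 8 = (7 :: nat)" "57 mod 8 = (1 :: nat)" "57 div 8 = (7 :: nat)"
  "58 mod 8 = (2 :: nat)" "58 div 8 = (7 :: nat)" "59 mod 8 = (3 :: nat)" "59 div 8 = (7 :: nat)"
  "60 mod 8 = (4 :: nat)" "60 div 8 = (7 :: nat)" "61 mod 8 = (5 :: nat)" "61 div 8 = (7 :: nat)"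
  "62 mod 8 = (6 :: nat)" "62 div 8 = (7 :: nat)" "63 mod 8 = (7 :: nat)" "63 div 8 = (7 :: nat)"
  by simp_all

lemmas digit_arith = div_mod_8 arith_simps add_num_simps mult_1_left mult_1_right add_0_left add_0_right
  mult_zero_left mult_zero_right one_plus_numeral numeral_plus_one one_add_one

definition "muladd_digit_rule d c x \<longleftrightarrow> all_digits (\<lambda>y. \<forall>xs ys.
  muladd_digit d c (x # xs) (y # ys) =
    ((d * x + y + c) mod 8) # muladd_digit d ((d * x + y + c) div 8) xs ys)"

lemma muladd_digit_all: "all_digits (\<lambda>d. all_digits (\<lambda>c. all_digits (muladd_digit_rule d c)))"
  by (intro all_digitsI) (simp add: muladd_digit_rule_def all_digits_def muladd_digit.simps)

lemmas muladd_digit_table = muladd_digit_all[unfolded all_digits_def muladd_digit_rule_def,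
  simplified digit_arith, folded muladd_defs, folded cons_defs]

definition "muladd_digit_Nil_rule d c \<longleftrightarrow> (\<forall>ys. muladd_digit d c [] ys = [c]) \<and> all_digits (\<lambda>x. \<forall>xs.
  muladd_digit d c (x # xs) [] = ((d * x + c) mod 8) # muladd_digit d ((d * x + c) div 8) xs [])"

lemma muladd_digit_Nil_all: "all_digits (\<lambda>d. all_digits (muladd_digit_Nil_rule d))"
  by (intro all_digitsI) (simp add: muladd_digit_Nil_rule_def all_digits_def muladd_digit.simps)

lemmas muladd_digit_Nil_table = muladd_digit_Nil_all[unfolded all_digits_def muladd_digit_Nil_rule_def,
  simplified digit_arith, folded muladd_defs, folded cons_defs]

text \<open>The auxiliary functions \<open>muladd_next\<close> and \<open>check_next\<close> make the simplifier evaluate a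
  shared argument only once.\<close>

definition muladd_next :: "nat list \<Rightarrow> nat list \<Rightarrow> nat list \<Rightarrow> nat list" where
  "muladd_next ds ys v = hd v # muladd ds ys (tl v)"

lemma muladd_all: "all_digits (\<lambda>d. \<forall>ds ys acc.
    (d \<noteq> 0 \<longrightarrow> muladd (d # ds) ys acc = muladd_next ds ys (muladd_digit d 0 ys acc)) \<and>
    muladd_next ds ys (d # acc) = d # muladd ds ys acc \<and>
    muladd (0 # ds) ys (d # acc) = d # muladd ds ys acc)"
  by (intro all_digitsI) (simp add: muladd.simps muladd_next_def)

lemma muladd_zero: "muladd (0 # ds) ys [] = 0 # muladd ds ys []"
  by (simp add: muladd.simps)

text \<open>Simplification may leave the digits 1 and 2 in \<open>Suc\<close> form; folding them
  back allows the digit constants to be recognised.\<close>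

lemmas muladd_table =
  muladd_all[unfolded all_digits_def, simplified, folded numeral_2_eq_2, folded One_nat_def,
    folded muladd_defs, folded cons_defs] muladd_zero[folded cons_defs] muladd.simps(1)

definition "add_carry_rule x \<longleftrightarrow> (\<forall>xs.
  add_carry (x # xs) [] True = ((x + 1) mod 8) # add_carry xs [] (8 \<le> x + 1) \<and>
  add_carry [] (x # xs) True = ((x + 1) mod 8) # add_carry [] xs (8 \<le> x + 1)) \<and>
  all_digits (\<lambda>y. \<forall>xs ys.
    add_carry (x # xs) (y # ys) False = ((x + y) mod 8) # add_carry xs ys (8 \<le> x + y) \<and>
    add_carry (x # xs) (y # ys) True = ((x + y + 1) mod 8) # add_carry xs ys (8 \<le> x + y + 1))"

lemma add_carry_all: "all_digits add_carry_rule"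
  by (intro all_digitsI) (simp add: add_carry_rule_def all_digits_def add_carry.simps)

lemma add_carry_Nil: "add_carry xs [] False = xs" "add_carry [] xs False = xs" "add_carry [] [] True = [1]"
  by (cases xs; simp add: add_carry.simps)+

lemmas add_carry_table = add_carry_Nil[folded cons_defs flag_defs]
  add_carry_all[unfolded all_digits_def add_carry_rule_def, simplified, folded numeral_2_eq_2,
    folded One_nat_def, folded cons_defs flag_defs]

definition "subtract_rev_rule x \<longleftrightarrow> (\<forall>xs acc.
  subtract_rev (x # xs) [] False acc = subtract_rev xs [] False ((8 + x) mod 8 # acc) \<and>
  subtract_rev (x # xs) [] True acc = subtract_rev xs [] (x < 1) ((8 + x - 1) mod 8 # acc)) \<and>
  all_digits (\<lambda>y. \<forall>xs ys acc.
    subtract_rev (x # xs) (y # ys) False acc = subtract_rev xs ys (x < y) ((8 + x - y) mod 8 # acc) \<and>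
    subtract_rev (x # xs) (y # ys) True acc =
      subtract_rev xs ys (x < y + 1) ((8 + x - (y + 1)) mod 8 # acc))"

lemma subtract_rev_all: "all_digits subtract_rev_rule"
  by (intro all_digitsI) (simp add: subtract_rev_rule_def all_digits_def subtract_rev.simps)

lemma subtract_rev_Nil: "subtract_rev [] [] False acc = acc"
  "subtract_rev [] (0 # ys) False acc = subtract_rev [] ys False acc"
  by (simp_all add: subtract_rev.simps)

lemmas subtract_rev_table = subtract_rev_Nil[folded cons_defs flag_defs]
  subtract_rev_all[unfolded all_digits_def subtract_rev_rule_def, simplified, folded numeral_2_eq_2,
    folded One_nat_def, folded cons_defs flag_defs]

definition "below_rule x \<longleftrightarrow> (\<forall>xs.
  below (x # xs) [] False = below xs [] False \<and> below (x # xs) [] True = below xs [] (x = 0) \<and>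
  below [] (x # xs) False = below [] xs (0 < x) \<and> below [] (x # xs) True = below [] xs True) \<and>
  all_digits (\<lambda>y. \<forall>xs ys.
    below (x # xs) (y # ys) False = below xs ys (x < y) \<and>
    below (x # xs) (y # ys) True = below xs ys (x < y \<or> x = y))"

lemma below_all: "all_digits below_rule"
  by (intro all_digitsI) (simp add: below_rule_def all_digits_def below.simps)

lemmas below_table = below.simps(1)[of False, folded flag_defs] below.simps(1)[of True, folded flag_defs]
  below_all[unfolded all_digits_def below_rule_def, simplified, folded numeral_2_eq_2, folded
    One_nat_def, folded cons_defs flag_defs]

lemma shift_all: "all_digits (\<lambda>x. \<forall>p l xs acc.
    take_rev (Suc p) (x # xs) acc = take_rev p xs (x # acc) \<and> drop (Suc p) (x # xs) = drop p xs \<and>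
    count_digits p (x # xs) acc l = count_digits p xs (x # acc) (Suc l))"
  by (intro all_digitsI) (simp add: take_rev.simps count_digits.simps)

lemmas shift_table = shift_all[unfolded all_digits_def, folded cons_defs flag_defs] take_rev.simps(1)
  drop_0[where 'a = nat, folded flag_defs] drop_Nil[where 'a = nat, folded flag_defs]

definition initial_entry :: "nat \<Rightarrow> nat \<Rightarrow> nat list \<Rightarrow> nat list" where
  "initial_entry p l acc = (if l < p then [] else l # Suc 0 # take_rev p acc [])"

lemma leading_all: "all_digits (\<lambda>x. x \<noteq> 0 \<longrightarrow> (\<forall>G q p r l S j xs.
    strip G q r S j (x # xs) = guard G r S j (take_rev q (x # xs) []) \<and>
    count_digits p [] (x # xs) l = initial_entry p l (x # xs)))"
  by (intro all_digitsI) (simp add: strip.simps count_digits.simps initial_entry_def)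

lemma strip_zero: "strip G q r S (Suc j) (0 # xs) = strip G q r S j xs"
  by (simp add: strip.simps)

lemmas leading_table = leading_all[unfolded all_digits_def, simplified, folded numeral_2_eq_2,
  folded One_nat_def, folded cons_defs flag_defs]
  strip_zero[folded cons_defs]

lemma entry_True: "entry r j m True = j # r # m"
  by (simp add: entry_def)

definition check_next ::
    "nat list \<Rightarrow> nat \<Rightarrow> (nat \<times> nat list) list \<Rightarrow> nat list list \<Rightarrow> nat list list \<Rightarrow> bool" where
  "check_next t p sched ts vs \<longleftrightarrow> run t p sched (float_row p vs) \<and> check_rows t p sched ts vs"

lemma check_rows_Cons: "check_rows t p sched (v # ts) vs \<longleftrightarrow> check_next t p sched ts (pascal [] vs v)"
  by (simp add: check_next_def)

lemmas row_rules = pascal.simps[folded flag_defs] add_carry_table extend_rows.simps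

text \<open>Mostly the equations met by a successful run; a run that fails does not rewrite to
  \<open>True\<close>.\<close>

lemmas evaluation = muladd_digit_table muladd_digit_Nil_table muladd_table subtract_rev_table below_table
  shift_table leading_table initial_entry_def entry_True guard_def[folded flag_defs]
    entry_of_def[folded cons_defs flag_defs] L_entry_def
  L_entries.simps(1,2) with_difference.simps with_shift.simps update_tail.simps(1,2,3) update.simps(1)
  add_Suc_shift add_0_left diff_Suc_Suc minus_nat.diff_0 Suc_less_eq not_less_zero if_False
  final_test_def[folded cons_defs flag_defs] final.simps(1,2) run.simps
  float_row_def list.map check_next_def check_rows_Cons check_rows.simps(1) simp_thms

text \<open>Three bits of a binary numeral are one octal digit, so conversion is pattern matching
  without arithmetic.\<close>

lemma octal_digits_num:
  "octal_digits (numeral (num.Bit0 (num.Bit0 (num.Bit0 n)))) = o0 (octal_digits (numeral n))"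
  "octal_digits (numeral (num.Bit1 (num.Bit0 (num.Bit0 n)))) = o1 (octal_digits (numeral n))"
  "octal_digits (numeral (num.Bit0 (num.Bit1 (num.Bit0 n)))) = o2 (octal_digits (numeral n))"
  "octal_digits (numeral (num.Bit1 (num.Bit1 (num.Bit0 n)))) = o3 (octal_digits (numeral n))"
  "octal_digits (numeral (num.Bit0 (num.Bit0 (num.Bit1 n)))) = o4 (octal_digits (numeral n))"
  "octal_digits (numeral (num.Bit1 (num.Bit0 (num.Bit1 n)))) = o5 (octal_digits (numeral n))"
  "octal_digits (numeral (num.Bit0 (num.Bit1 (num.Bit1 n)))) = o6 (octal_digits (numeral n))"
  "octal_digits (numeral (num.Bit1 (num.Bit1 (num.Bit1 n)))) = o7 (octal_digits (numeral n))"
  "octal_digits 1 = o1 []" "octal_digits (numeral num.One) = o1 []"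
  "octal_digits 2 = o2 []"
  "octal_digits 3 = o3 []"
  "octal_digits 4 = o4 []"
  "octal_digits 5 = o5 []"
  "octal_digits 6 = o6 []"
  "octal_digits 7 = o7 []"
proof -
  have step: "octal_digits v = d # octal_digits N" if "v = 8 * N + d" "d < 8" "0 < N" for v d N
    using that by (subst octal_digits.simps) simp
  show "octal_digits (numeral (num.Bit0 (num.Bit0 (num.Bit0 n)))) = o0 (octal_digits (numeral n))"
    "octal_digits (numeral (num.Bit1 (num.Bit0 (num.Bit0 n)))) = o1 (octal_digits (numeral n))"
    "octal_digits (numeral (num.Bit0 (num.Bit1 (num.Bit0 n)))) = o2 (octal_digits (numeral n))"
    "octal_digits (numeral (num.Bit1 (num.Bit1 (num.Bit0 n)))) = o3 (octal_digits (numeral n))"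
    "octal_digits (numeral (num.Bit0 (num.Bit0 (num.Bit1 n)))) = o4 (octal_digits (numeral n))"
    "octal_digits (numeral (num.Bit1 (num.Bit0 (num.Bit1 n)))) = o5 (octal_digits (numeral n))"
    "octal_digits (numeral (num.Bit0 (num.Bit1 (num.Bit1 n)))) = o6 (octal_digits (numeral n))"
    "octal_digits (numeral (num.Bit1 (num.Bit1 (num.Bit1 n)))) = o7 (octal_digits (numeral n))"
    unfolding cons_defs by - (rule step, simp only: numeral.simps distrib_right mult_1_left add_ac
      add_0_right, simp, simp)+
qed (simp_all add: octal_digits.simps cons_defs)

lemmas row_evaluation = row_rules octal_digits_num list.map arith_simps add_num_simps add_0_left

text \<open>Precisions, exponents and digit counts are unary, so that subtraction and comparison
  just remove \<open>Suc\<close>; the digits of \<open>t\<close> and \<open>G\<close> are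
  \<open>o0\<close> to \<open>o7\<close> and remain untouched.\<close>

lemma unary:
  "1 = Suc 0" "2 = Suc 1" "3 = Suc 2" "4 = Suc 3" "5 = Suc 4" "6 = Suc 5"
  "7 = Suc 6" "8 = Suc 7" "9 = Suc 8" "10 = Suc 9" "11 = Suc 10" "12 = Suc 11"
  "13 = Suc 12" "14 = Suc 13" "15 = Suc 14" "16 = Suc 15"
  by simp_all

lemmas error_evaluation = initial_error_def cons_defs power2_eq_square

section \<open>Numerical verification of the thirty blocks\<close>

text \<open>The precisions and cancellation bounds of the schedules were found numerically.\<close>

lemma block_0: "block 0 = map octal_digits
  [1152921504606846976, 576460752303423488, 384307168202282325, 288230376151711744,
    230584300921369395, 192153584101141162, 164703072086692425, 144115188075855872,
    128102389400760775, 115292150460684697]"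
  by (rule block_eqI) simp_all

lemmas row_0 = harm_row.simps(1)

text \<open>The arguments are the threshold \<open>t\<close>, the initial precision and the
  schedule. Digits are written lowest first: \<open>o2 (o2 [])\<close> is 18, and the two
  cancellation bounds are 4 and 2.\<close>

lemma verified_block_0: "verified_block 0"
  by (rule verified_blockI[of _ "o2 (o2 [])" 5
      "[(4, o4 []), (3, o2 [])]", unfolded unary])
    (simp, simp only: evaluation row_rules octal_digits_num block_0 row_0,
      simp_all add: error_evaluation)

lemma block_10: "block 10 = map octal_digits
  [104811045873349725, 96076792050570581, 88686269585142075, 82351536043346212,
    76861433640456465, 72057594037927936, 67818912035696880, 64051194700380387,
    60680079189834051, 57646075230342348]"
  by (rule block_eqI) simp_all

lemmas row_10 = harm_row_block[of 0, simplified row_evaluation block_0 row_0]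

lemma verified_block_10: "verified_block 10"
  by (rule verified_blockI[of _ "o0 (o2 [])" 7
      "[(5, o6 []), (4, o4 []), (3, o2 [])]", unfolded unary])
    (simp, simp only: evaluation row_rules octal_digits_num block_10 row_10,
      simp_all add: error_evaluation)

lemma block_20: "block 20 = map octal_digits
  [54901024028897475, 52405522936674862, 50127021939428129, 48038396025285290,
    46116860184273879, 44343134792571037, 42700796466920258, 41175768021673106,
    39755913951960240, 38430716820228232]"
  by (rule block_eqI) simp_all

lemmas row_20 = harm_row_block[of 10, simplified row_evaluation block_10 row_10]

text \<open>Here \<open>t = 24\<close>, the largest integer for which
  \<open>26181 / 10000 * (t / 64)\<close> is below 1; a small final error pays for it.\<close>

lemma verified_block_20: "verified_block 20"
  by (rule verified_blockI[of _ "o0 (o3 [])" 9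
      "[(7, o1 (o1 [])), (6, o5 []), (4, o3 [])]", unfolded unary])
    (simp, simp only: evaluation row_rules octal_digits_num block_20 row_20,
      simp_all add: error_evaluation)

lemma block_30: "block 30 = map octal_digits
  [37191016277640225, 36028797018963968, 34937015291116575, 33909456017848440,
    32940614417338485, 32025597350190193, 31160040665049918, 30340039594917025,
    29562089861714025, 28823037615171174]"
  by (rule block_eqI) simp_all

lemmas row_30 = harm_row_block[of 20, simplified row_evaluation block_20 row_20]

text \<open>From here on schedules gain a step exactly at rows 31, 61, 121 and 241: doubling
  \<open>n\<close> doubles the initial cancellation, and one more halving compensates for
  it.\<close>

lemma verified_block_30: "verified_block 30"
  by (rule verified_blockI[of _ "o7 (o1 [])" 8
      "[(7, o3 (o1 [])), (6, o6 []), (4, o4 []), (3, o2 [])]", unfolded unary])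
    (simp, simp only: evaluation row_rules octal_digits_num block_30 row_30,
      simp_all add: error_evaluation)

lemma block_40: "block 40 = map octal_digits
  [28120036697727975, 27450512014448737, 26812128014112720, 26202761468337431,
    25620477880152155, 25063510969714064, 24530244778869084, 24019198012642645,
    23529010298098917, 23058430092136939]"
  by (rule block_eqI) simp_all

lemmas row_40 = harm_row_block[of 30, simplified row_evaluation block_30 row_30]

lemma verified_block_40: "verified_block 40"
  by (rule verified_blockI[of _ "o4 (o2 [])" 9
      "[(8, o6 (o1 [])), (6, o0 (o1 [])), (5, o4 []), (3, o3 [])]", unfolded unary])
    (simp, simp only: evaluation row_rules octal_digits_num block_40 row_40,
      simp_all add: error_evaluation)

lemma block_50: "block 50 = map octal_digits
  [22606304011898960, 22171567396285518, 21753235935978244, 21350398233460129,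
    20962209174669945, 20587884010836553, 20226693063278017, 19877956975980120,
    19541042450963508, 19215358410114116]"
  by (rule block_eqI) simp_all

lemmas row_50 = harm_row_block[of 40, simplified row_evaluation block_40 row_40]

lemma verified_block_50: "verified_block 50"
  by (rule verified_blockI[of _ "o0 (o3 [])" 11
      "[(9, o0 (o2 [])), (7, o1 (o1 [])), (6, o5 []), (4, o3 [])]", unfolded unary])
    (simp, simp only: evaluation row_rules octal_digits_num block_50 row_50,
      simp_all add: error_evaluation)

lemma block_60: "block 60 = map octal_digits
  [18900352534538475, 18595508138820112, 18300341342965825, 18014398509481984,
    17737253917028415, 17468507645558287, 17207783650848462, 16954728008924220,
    16709007313142709, 16470307208669242]"
  by (rule block_eqI) simp_all

lemmas row_60 = harm_row_block[of 50, simplified row_evaluation block_50 row_50]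

lemma verified_block_60: "verified_block 60"
  by (rule verified_blockI[of _ "o4 (o1 [])" 10
      "[(8, o3 (o2 [])), (7, o2 (o1 [])), (5, o6 []), (4, o3 []), (3, o2 [])]", unfolded unary])
    (simp, simp only: evaluation row_rules octal_digits_num block_60 row_60,
      simp_all add: error_evaluation)

lemma block_70: "block 70 = map octal_digits
  [16238331050800661, 16012798675095096, 15793445268586944, 15580020332524959,
    15372286728091293, 15170019797458512, 14973006553335675, 14781044930857012,
    14593943096289202, 14411518807585587]"
  by (rule block_eqI) simp_all

lemmas row_70 = harm_row_block[of 60, simplified row_evaluation block_60 row_60]

lemma verified_block_70: "verified_block 70"
  by (rule verified_blockI[of _ "o6 (o1 [])" 11
      "[(8, o5 (o2 [])), (7, o3 (o1 [])), (6, o6 []), (4, o4 []), (3, o2 [])]", unfolded unary])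
    (simp, simp only: evaluation row_rules octal_digits_num block_70 row_70,
      simp_all add: error_evaluation)

lemma block_80: "block 80 = map octal_digits
  [14233598822306752, 14060018348863987, 13890620537431891, 13725256007224368,
    13563782407139376, 13406064007056360, 13251971317320080, 13101380734168715,
    12954174209065696, 12810238940076077]"
  by (rule block_eqI) simp_all

lemmas row_80 = harm_row_block[of 70, simplified row_evaluation block_70 row_70]

lemma verified_block_80: "verified_block 80"
  by (rule verified_blockI[of _ "o1 (o2 [])" 11
      "[(9, o0 (o3 [])), (7, o5 (o1 [])), (6, o7 []), (5, o4 []), (3, o3 [])]", unfolded unary])
    (simp, simp only: evaluation row_rules octal_digits_num block_80 row_80,
      simp_all add: error_evaluation)

lemma block_90: "block 90 = map octal_digits
  [12669467083591725, 12531755484857032, 12397005425880075, 12265122389434542,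
    12136015837966810, 12009599006321322, 11885788707287082, 11764505149049458,
    11645671763705525, 11529215046068469]"
  by (rule block_eqI) simp_all

lemmas row_90 = harm_row_block[of 80, simplified row_evaluation block_80 row_80]

lemma verified_block_90: "verified_block 90"
  by (rule verified_blockI[of _ "o3 (o2 [])" 11
      "[(9, o2 (o3 [])), (8, o6 (o1 [])), (6, o7 []), (5, o4 []), (4, o3 [])]", unfolded unary])
    (simp, simp only: evaluation row_rules octal_digits_num block_90 row_90,
      simp_all add: error_evaluation)

lemma block_100: "block 100 = map octal_digits
  [11415064402047989, 11303152005949480, 11193412666085892, 11085783698142759,
    10980204805779495, 10876617967989122, 10774967332774270, 10675199116730064,
    10577261510154559, 10481104587334972]"
  by (rule block_eqI) simp_all

lemmas row_100 = harm_row_block[of 90, simplified row_evaluation block_90 row_90]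

lemma verified_block_100: "verified_block 100"
  by (rule verified_blockI[of _ "o6 (o2 [])" 12
      "[(10, o5 (o3 [])), (8, o7 (o1 [])), (6, o0 (o1 [])), (5, o5 []), (4, o3 [])]", unfolded unary])
    (simp, simp only: evaluation row_rules octal_digits_num block_100 row_100,
      simp_all add: error_evaluation)

lemma block_110: "block 110 = map octal_digits
  [10386680221683306, 10293942005418276, 10202845173511920, 10113346531639008,
    10025404387885625, 9938978487990060, 9854029953904675, 9770521225481754,
    9688416005099554, 9607679205057058]"
  by (rule block_eqI) simp_all

lemmas row_110 = harm_row_block[of 100, simplified row_evaluation block_100 row_100]

lemma verified_block_110: "verified_block 110"
  by (rule verified_blockI[of _ "o0 (o3 [])" 13
      "[(11, o7 (o3 [])), (9, o0 (o2 [])), (7, o1 (o1 [])), (6, o5 []), (5, o3 [])]", unfolded unary])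
    (simp, simp only: evaluation row_rules octal_digits_num block_110 row_110,
      simp_all add: error_evaluation)

lemma block_120: "block 120 = map octal_digits
  [9528276897577247, 9450176267269237, 9373345565909325, 9297754069410056,
    9223372036854775, 9150170671482912, 9078122083518480, 9007199254740992,
    8937376004704240, 8868626958514207]"
  by (rule block_eqI) simp_all

lemmas row_120 = harm_row_block[of 110, simplified row_evaluation block_110 row_110]

lemma verified_block_120: "verified_block 120"
  by (rule verified_blockI[of _ "o2 (o1 [])" 13
      "[(10, o2 (o4 [])), (8, o2 (o2 [])), (7, o1 (o1 [])), (5, o5 []), (4, o3 []), (3, o2 [])]", unfolded unary])
    (simp, simp only: evaluation row_rules octal_digits_num block_120 row_120,
      simp_all add: error_evaluation)

lemma block_130: "block 130 = map octal_digits
  [8800927516082801, 8734253822779143, 8668582741404864, 8603891825424231,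
    8540159293384051, 8477364004462110, 8415485435086474, 8354503656571354,
    8294399313718323, 8235153604334621]"
  by (rule block_eqI) simp_all

lemmas row_130 = harm_row_block[of 120, simplified row_evaluation block_120 row_120]

lemma verified_block_130: "verified_block 130"
  by (rule verified_blockI[of _ "o4 (o1 [])" 13
      "[(10, o4 (o4 [])), (8, o3 (o2 [])), (7, o2 (o1 [])), (6, o6 []), (4, o3 []), (3, o2 [])]", unfolded unary])
    (simp, simp only: evaluation row_rules octal_digits_num block_130 row_130,
      simp_all add: error_evaluation)

lemma block_140: "block 140 = map octal_digits
  [8176748259623028, 8119165525400330, 8062388144103825, 8006399337547548,
    7951182790392048, 7896722634293472, 7843003432699639, 7790010166262479,
    7737728218837899, 7686143364045646]"
  by (rule block_eqI) simp_all

lemmas row_140 = harm_row_block[of 130, simplified row_evaluation block_130 row_130]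

lemma verified_block_140: "verified_block 140"
  by (rule verified_blockI[of _ "o5 (o1 [])" 13
      "[(10, o7 (o4 [])), (9, o4 (o2 [])), (7, o3 (o1 [])), (5, o6 []), (4, o3 []), (3, o2 [])]", unfolded unary])
    (simp, simp only: evaluation row_rules octal_digits_num block_140 row_140,
      simp_all add: error_evaluation)

lemma block_150: "block 150 = map octal_digits
  [7635241752363225, 7585009898729256, 7535434670632986, 7486503276667837,
    7438203255528045, 7390522465428506, 7343449073928961, 7296971548144601,
    7251078645326081, 7205759403792793]"
  by (rule block_eqI) simp_all

lemmas row_150 = harm_row_block[of 140, simplified row_evaluation block_140 row_140]

lemma verified_block_150: "verified_block 150"
  by (rule verified_blockI[of _ "o6 (o1 [])" 13
      "[(11, o2 (o5 [])), (9, o5 (o2 [])), (7, o3 (o1 [])), (5, o6 []), (4, o4 []), (3, o2 [])]", unfolded unary])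
    (simp, simp only: evaluation row_rules octal_digits_num block_150 row_150,
      simp_all add: error_evaluation)

lemma block_160: "block 160 = map octal_digits
  [7161003134204018, 7116799411153376, 7073138065072680, 7030009174431993,
    6987403058223315, 6945310268715945, 6903721584472137, 6862628003612184,
    6822020737318621, 6781891203569688]"
  by (rule block_eqI) simp_all

lemmas row_160 = harm_row_block[of 150, simplified row_evaluation block_150 row_150]

lemma verified_block_160: "verified_block 160"
  by (rule verified_blockI[of _ "o7 (o1 [])" 13
      "[(11, o4 (o5 [])), (9, o7 (o2 [])), (7, o4 (o1 [])), (5, o6 []), (4, o4 []), (4, o2 [])]", unfolded unary])
    (simp, simp only: evaluation row_rules octal_digits_num block_160 row_160,
      simp_all add: error_evaluation)

lemma block_170: "block 170 = map octal_digits
  [6742231021092672, 6703032003528180, 6664286153796803, 6625985658660040,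
    6588122883467697, 6550690367084357, 6513680816987836, 6477087104532848,
    6440902260373446, 6405119470038038]"
  by (rule block_eqI) simp_all

lemmas row_170 = harm_row_block[of 160, simplified row_evaluation block_160 row_160]

lemma verified_block_170: "verified_block 170"
  by (rule verified_blockI[of _ "o1 (o2 [])" 14
      "[(11, o7 (o5 [])), (9, o0 (o3 [])), (7, o5 (o1 [])), (6, o7 []), (5, o4 []), (4, o3 [])]", unfolded unary])
    (simp, simp only: evaluation row_rules octal_digits_num block_170 row_170,
      simp_all add: error_evaluation)

lemma block_180: "block 180 = map octal_digits
  [6369732069651088, 6334733541795862, 6300117511512825, 6265877742428516,
    6232008133009983, 6198502712940037, 6165355639608807, 6132561194717271,
    6100113780988608, 6068007918983405]"
  by (rule block_eqI) simp_all

lemmas row_180 = harm_row_block[of 170, simplified row_evaluation block_170 row_170]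

lemma verified_block_180: "verified_block 180"
  by (rule verified_blockI[of _ "o2 (o2 [])" 14
      "[(11, o1 (o6 [])), (9, o1 (o3 [])), (8, o5 (o1 [])), (6, o7 []), (5, o4 []), (4, o3 [])]", unfolded unary])
    (simp, simp only: evaluation row_rules octal_digits_num block_180 row_180,
      simp_all add: error_evaluation)

lemma block_190: "block 190 = map octal_digits
  [6036238244014905, 6004799503160661, 5973686552367082, 5942894353643541,
    5912417972342805, 5882252574524729, 5852393424400238, 5822835881852762,
    5793575400034406, 5764607523034234]"
  by (rule block_eqI) simp_all

lemmas row_190 = harm_row_block[of 180, simplified row_evaluation block_180 row_180]

lemma verified_block_190: "verified_block 190"
  by (rule verified_blockI[of _ "o3 (o2 [])" 14
      "[(12, o4 (o6 [])), (9, o2 (o3 [])), (8, o6 (o1 [])), (6, o7 []), (5, o4 []), (3, o3 [])]", unfolded unary])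
    (simp, simp only: evaluation row_rules octal_digits_num block_190 row_190,
      simp_all add: error_evaluation)

lemma block_200: "block 200 = map octal_digits
  [5735927883616154, 5707532201023994, 5679416278851462, 5651576002974740,
    5624007339545595, 5596706333042946, 5569669104380903, 5542891849071379,
    5516370835439459, 5490102402889747]"
  by (rule block_eqI) simp_all

lemmas row_200 = harm_row_block[of 190, simplified row_evaluation block_190 row_190]

lemma verified_block_200: "verified_block 200"
  by (rule verified_blockI[of _ "o4 (o2 [])" 14
      "[(12, o6 (o6 [])), (10, o4 (o3 [])), (8, o6 (o1 [])), (6, o0 (o1 [])), (5, o4 []),
        (4, o3 [])]", unfolded unary])
    (simp, simp only: evaluation row_rules octal_digits_num block_200 row_200,
      simp_all add: error_evaluation)

lemma block_210: "block 210 = map octal_digits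
  [5464082960222023, 5438308983994561, 5412777016933553, 5387483666387135,
    5362425602822544, 5337599558365032, 5313002325377175, 5288630755077279,
    5264481756195648, 5240552293667486]"
  by (rule block_eqI) simp_all

lemmas row_210 = harm_row_block[of 200, simplified row_evaluation block_200 row_200]

lemma verified_block_210: "verified_block 210"
  by (rule verified_blockI[of _ "o5 (o2 [])" 15
      "[(12, o1 (o7 [])), (10, o5 (o3 [])), (8, o7 (o1 [])), (6, o0 (o1 [])), (5, o5 []),
        (4, o3 [])]", unfolded unary])
    (simp, simp only: evaluation row_rules octal_digits_num block_210 row_210,
      simp_all add: error_evaluation)

lemma block_220: "block 220 = map octal_digits
  [5216839387361298, 5193340110841653, 5170051590165233, 5146971002709138,
    5124095576030431, 5101422586755960, 5078949359501528, 5056673265819504,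
    5034591723174004, 5012702193942812]"
  by (rule block_eqI) simp_all

lemmas row_220 = harm_row_block[of 210, simplified row_evaluation block_210 row_210]

lemma verified_block_220: "verified_block 220"
  by (rule verified_blockI[of _ "o6 (o2 [])" 15
      "[(12, o3 (o7 [])), (10, o6 (o3 [])), (8, o0 (o2 [])), (7, o0 (o1 [])), (5, o5 []),
        (4, o3 [])]", unfolded unary])
    (simp, simp only: evaluation row_rules octal_digits_num block_220 row_220,
      simp_all add: error_evaluation)

lemma block_230: "block 230 = map octal_digits
  [4991002184445225, 4969489243995030, 4948160963977884, 4927014976952337,
    4906048955773816, 4885260612740877, 4864647698763067, 4844208002549777,
    4823939349819443, 4803839602528529]"
  by (rule block_eqI) simp_all

lemmas row_230 = harm_row_block[of 220, simplified row_evaluation block_220 row_220]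

lemma verified_block_230: "verified_block 230"
  by (rule verified_blockI[of _ "o7 (o2 [])" 15
      "[(13, o6 (o7 [])), (10, o7 (o3 [])), (9, o0 (o2 [])), (7, o1 (o1 [])), (5, o5 []),
        (5, o3 [])]", unfolded unary])
    (simp, simp only: evaluation row_rules octal_digits_num block_230 row_230,
      simp_all add: error_evaluation)

lemma block_240: "block 240 = map octal_digits
  [4783906658119696, 4764138448788623, 4744532940768917, 4725088133634618,
    4705802059619783, 4686672782954662, 4667698399218003, 4648877034705028,
    4630206845810630, 4611686018427387]"
  by (rule block_eqI) simp_all

lemmas row_240 = harm_row_block[of 230, simplified row_evaluation block_230 row_230]

text \<open>The first cancellation bound reaches 64 and needs a third octal digit; this is also the
  first schedule of seven steps.\<close>

lemma verified_block_240: "verified_block 240"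
  by (rule verified_blockI[of _ "o1 (o1 [])" 15
      "[(13, o0 (o0 (o1 []))), (10, o1 (o4 [])), (9, o1 (o2 [])), (7, o1 (o1 [])), (5, o5 []),
        (4, o3 []), (3, o2 [])]", unfolded unary])
    (simp, simp only: evaluation row_rules octal_digits_num block_240 row_240,
      simp_all add: error_evaluation)

lemma block_250: "block 250 = map octal_digits
  [4593312767357956, 4575085335741456, 4557001994493466, 4539061041759240,
    4521260802379792, 4503599627370496, 4486075893411855, 4468688002352120,
    4451434380721416, 4434313479257103]"
  by (rule block_eqI) simp_all

lemmas row_250 = harm_row_block[of 240, simplified row_evaluation block_240 row_240]

lemma verified_block_250: "verified_block 250"
  by (rule verified_blockI[of _ "o2 (o1 [])" 15
      "[(13, o3 (o0 (o1 []))), (10, o2 (o4 [])), (9, o2 (o2 [])), (7, o1 (o1 [])), (5, o5 []),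
        (4, o3 []), (3, o2 [])]", unfolded unary])
    (simp, simp only: evaluation row_rules octal_digits_num block_250 row_250,
      simp_all add: error_evaluation)

lemma block_260: "block 260 = map octal_digits
  [4417323772440026, 4400463758041400, 4383731956680026, 4367126911389571,
    4350647187195648, 4334291370702432, 4318058069688565, 4301945912712115,
    4285953548724338, 4270079646692025]"
  by (rule block_eqI) simp_all

lemmas row_260 = harm_row_block[of 250, simplified row_evaluation block_250 row_250]

lemma verified_block_260: "verified_block 260"
  by (rule verified_blockI[of _ "o3 (o1 [])" 15
      "[(13, o5 (o0 (o1 []))), (10, o3 (o4 [])), (9, o2 (o2 [])), (7, o2 (o1 [])), (5, o5 []),
        (4, o3 []), (3, o2 [])]", unfolded unary])
    (simp, simp only: evaluation row_rules octal_digits_num block_260 row_260,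
      simp_all add: error_evaluation)

lemma block_270: "block 270 = map octal_digits
  [4254322895228217, 4238682002231055, 4223155694530575, 4207742717543237,
    4192441834933989, 4177251828285677, 4162171496775620, 4147199656859161,
    4132335141960025, 4117576802167310]"
  by (rule block_eqI) simp_all

lemmas row_270 = harm_row_block[of 260, simplified row_evaluation block_260 row_260]

lemma verified_block_270: "verified_block 270"
  by (rule verified_blockI[of _ "o3 (o1 [])" 16
      "[(13, o0 (o1 (o1 []))), (10, o5 (o4 [])), (8, o3 (o2 [])), (7, o2 (o1 [])), (5, o5 []),
        (4, o3 []), (3, o2 [])]", unfolded unary])
    (simp, simp only: evaluation row_rules octal_digits_num block_270 row_270,
      simp_all add: error_evaluation)

lemma block_280: "block 280 = map octal_digits
  [4102923503938957, 4088374129811514, 4073927578116067, 4059582762700165,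
    4045338612655603, 4031194072051912, 4017148099675425, 4003199668773774,
    3989347766805698, 3975591395196024]"
  by (rule block_eqI) simp_all

lemmas row_280 = harm_row_block[of 270, simplified row_evaluation block_270 row_270]

lemma verified_block_280: "verified_block 280"
  by (rule verified_blockI[of _ "o4 (o1 [])" 15
      "[(13, o2 (o1 (o1 []))), (11, o6 (o4 [])), (9, o3 (o2 [])), (7, o2 (o1 [])), (5, o6 []),
        (4, o3 []), (3, o2 [])]", unfolded unary])
    (simp, simp only: evaluation row_rules octal_digits_num block_280 row_280,
      simp_all add: error_evaluation)

lemma block_290: "block 290 = map octal_digits
  [3961929569095694, 3948361317146736, 3934885681252037, 3921501716349819,
    3908208490192701, 3895005083131239, 3881890587901841, 3868864109418949,
    3855924764571394, 3843071682022823]"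
  by (rule block_eqI) simp_all

lemmas row_290 = harm_row_block[of 280, simplified row_evaluation block_280 row_280]

text \<open>The cancellation bounds 77, 39, 20, 11, 6, 3, 2 show the halving, starting near
  \<open>300 / 4\<close>.\<close>

lemma verified_block_290: "verified_block 290"
  by (rule verified_blockI[of _ "o5 (o1 [])" 16
      "[(13, o5 (o1 (o1 []))), (11, o7 (o4 [])), (8, o4 (o2 [])), (7, o3 (o1 [])), (5, o6 []),
        (4, o3 []), (3, o2 [])]", unfolded unary])
    (simp, simp only: evaluation row_rules octal_digits_num block_290 row_290,
      simp_all add: error_evaluation)

lemma all_blocks_verified: "b < 30 \<Longrightarrow> verified_block (10 * b)"
proof -
  have "\<forall>n\<in>set (map ((*) 10) [0..<30]). verified_block n"
    by (simp add: upt_rec verified_block_0 verified_block_10 verified_block_20 verified_block_30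
      verified_block_40 verified_block_50 verified_block_60 verified_block_70 verified_block_80
      verified_block_90 verified_block_100 verified_block_110 verified_block_120 verified_block_130
      verified_block_140 verified_block_150 verified_block_160 verified_block_170 verified_block_180
      verified_block_190 verified_block_200 verified_block_210 verified_block_220 verified_block_230
      verified_block_240 verified_block_250 verified_block_260 verified_block_270 verified_block_280
      verified_block_290)
  then show "b < 30 \<Longrightarrow> verified_block (10 * b)" by simp
qed

theorem theorem4p5:
  fixes n :: nat
  assumes "1 \<le> n" and "n \<le> 300"
  shows "infinite_logconcave 1 (int n) (A_seq n)"
proof -
  \<comment> \<open>Block \<open>b\<close> covers the rows \<open>10 * b + 1\<close> to
    \<open>10 * b + 10\<close>, hence the shift by one before dividing.\<close>
  define b where "b = (n - 1) div 10"
  have "b < 30" "n \<in> {10 * b<..10 * b + 10}" using assms by (auto simp: b_def)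
  then show ?thesis using all_blocks_verified[of b] by (auto simp: verified_block_def)
qed

end
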